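(* Let $(\mathcal{X}_1,\mathcal{X}_2,\mathcal{X}_s,\omega,\mathcal{Y}_p,\mathcal{Y}_s)$ be a discrete memoryless channel as in the context, and let $\mathcal{R}^o$ be the closure of $\bigcup_{Z\in\mathcal{P}^*}\mathcal{R}^o(Z)$. Then every pair $(R_s,R_p)\in\mathcal{R}^o$ is achievable, i.e. there are nonnegative reals $R_1,R_2,S,T$ with $R_1+R_2=R_p$, $S+T=R_s$ such that $(R_1,R_2,S,T)$ is achievable for the rate-splitting channel $C_{RS}$.
   Context: Channel. $\mathcal{X}_1,\mathcal{X}_2,\mathcal{X}_s,\mathcal{Y}_p,\mathcal{Y}_s$ are finite sets and $\omega(y_py_s|x_1x_2x_s)$ is a conditional probability distribution on $\mathcal{Y}_p\times\mathcal{Y}_s$ given $(x_1,x_2,x_s)$, with marginals $\omega_p,\omega_s$; $\omega^n,\omega_p^n,\omega_s^n$ are the $n$-fold memoryless (product) extensions. Code for $C_{RS}$. A code $(n,M_1,M_2,L_s,N_s,\epsilon)$ for $C_{RS}$ consists of encoders $i\mapsto\mathbf{x}_{ai}\in\mathcal{X}_a^n$, $i\in\mathcal{M}_a=\{1,\dots,M_a\}$, $a=1,2$; a secondary encoder $(k,l)\mapsto\mathbf{x}_{skl}\in\mathcal{X}_s^n$ on $\mathcal{L}_s\times\mathcal{N}_s=\{1,\dots,L_s\}\times\{1,\dots,N_s\}$; disjoint decoding sets $\mathcal{D}_{pijl}\subseteq\mathcal{Y}_p^n$, $(i,j,l)\in\mathcal{M}_1\times\mathcal{M}_2\times\mathcal{N}_s$;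 and disjoint decoding sets $\mathcal{D}_{skl}\subseteq\mathcal{Y}_s^n$, $(k,l)\in\mathcal{L}_s\times\mathcal{N}_s$; such that $$\frac{1}{M_1M_2L_sN_s}\sum_{i,j,k,l}\omega_p^n(\mathbf{y}_p\notin\mathcal{D}_{pijl}|\mathbf{x}_{1i}\mathbf{x}_{2j}\mathbf{x}_{skl})\le\epsilon,\qquad\frac{1}{M_1M_2L_sN_s}\sum_{i,j,k,l}\omega_s^n(\mathbf{y}_s\notin\mathcal{D}_{skl}|\mathbf{x}_{1i}\mathbf{x}_{2j}\mathbf{x}_{skl})\le\epsilon.$$ A tuple $(R_1,R_2,S,T)$ of nonnegative reals is achievable for $C_{RS}$ if for every $\eta>0$, $0<\epsilon<1$, for all sufficiently large $n$, there is such a code with $\frac1n\log M_1\ge R_1-\eta$, $\frac1n\log M_2\ge R_2-\eta$, $\frac1n\log L_s\ge S-\eta$, $\frac1n\log N_s\ge T-\eta$ (logarithms in the same base as the mutual informations). $\mathcal{P}^*$ is the set of all tuples of random variables $Z=QUWX_1X_2X_sY_pY_s$, with $Q,U,W$ taking values in some finite sets and $X_a\in\mathcal{X}_a$, $Y_b\in\mathcal{Y}_b$, such that: $X_1,X_2,U,W$ are conditionally independent given $Q$; $X_s=f(UW|Q)$, i.e. $X_s$ is a deterministic function of $(U,W)$ for each value of $Q$; and given $(Q,U,W,X_1,X_2,X_s)$ the pair $(Y_p,Y_s)$ has conditional law $\omega(\cdot|X_1X_2X_s)$. $\mathcal{R}^o(Z)$ is the set of all pairs $(R_s,R_p)=(S+T,\,R_1+R_2)$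 with $(R_1,R_2,S,T)$ nonnegative reals satisfying $$R_1\le I(Y_p;X_1|WX_2Q),\quad R_2\le I(Y_p;X_2|WX_1Q),\quad T\le I(Y_p;W|X_1X_2Q),$$ $$R_1+R_2\le I(Y_p;X_1X_2|WQ),\quad T+R_1\le I(Y_p;WX_1|X_2Q),\quad T+R_2\le I(Y_p;WX_2|X_1Q),$$ $$T+R_1+R_2\le I(Y_p;WX_1X_2|Q),$$ $$S\le I(Y_s;U|WQ),\quad T\le I(Y_s;W|UQ),\quad S+T\le I(Y_s;UW|Q).$$ *)

theory Defs
  imports "HOL-Probability.Probability"
begin

text \<open>
  A channel is a kernel \<open>'x1 \<Rightarrow> 'x2 \<Rightarrow> 'xs \<Rightarrow> ('yp \<times> 'ys) pmf\<close> over finite types. Words of length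
  \<open>n\<close> are elements of \<open>{..<n} \<rightarrow>\<^sub>E UNIV\<close>, so the letters are numbered from 0; this agrees with the
  default value \<open>undefined\<close> outside \<open>{..<n}\<close> in the memoryless extension.
\<close>

definition memoryless ::
  "nat \<Rightarrow> ('x1 \<Rightarrow> 'x2 \<Rightarrow> 'xs \<Rightarrow> 'y pmf) \<Rightarrow> (nat \<Rightarrow> 'x1) \<Rightarrow> (nat \<Rightarrow> 'x2) \<Rightarrow> (nat \<Rightarrow> 'xs) \<Rightarrow> (nat \<Rightarrow> 'y) pmf"
  where "memoryless n V x1 x2 xs = Pi_pmf {..<n} undefined (\<lambda>t. V (x1 t) (x2 t) (xs t))"

definition marg_p :: "('x1 \<Rightarrow> 'x2 \<Rightarrow> 'xs \<Rightarrow> ('yp \<times> 'ys) pmf) \<Rightarrow> 'x1 \<Rightarrow> 'x2 \<Rightarrow> 'xs \<Rightarrow> 'yp pmf"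
  where "marg_p \<omega> x1 x2 xs = map_pmf fst (\<omega> x1 x2 xs)"

definition marg_s :: "('x1 \<Rightarrow> 'x2 \<Rightarrow> 'xs \<Rightarrow> ('yp \<times> 'ys) pmf) \<Rightarrow> 'x1 \<Rightarrow> 'x2 \<Rightarrow> 'xs \<Rightarrow> 'ys pmf"
  where "marg_s \<omega> x1 x2 xs = map_pmf snd (\<omega> x1 x2 xs)"

text \<open>
  The message sets are required to be nonempty: otherwise the average error would be 0 by the
  convention \<open>x / 0 = 0\<close>, and \<open>log b 0 = 0\<close> would turn an empty code into one of rate 0.
\<close>

definition is_code ::
  "('x1 \<Rightarrow> 'x2 \<Rightarrow> 'xs \<Rightarrow> ('yp \<times> 'ys) pmf) \<Rightarrow> nat \<Rightarrow> nat \<Rightarrow> nat \<Rightarrow> nat \<Rightarrow> nat \<Rightarrow> real \<Rightarrow>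
   (nat \<Rightarrow> nat \<Rightarrow> 'x1) \<Rightarrow> (nat \<Rightarrow> nat \<Rightarrow> 'x2) \<Rightarrow> (nat \<Rightarrow> nat \<Rightarrow> nat \<Rightarrow> 'xs) \<Rightarrow>
   (nat \<Rightarrow> nat \<Rightarrow> nat \<Rightarrow> (nat \<Rightarrow> 'yp) set) \<Rightarrow> (nat \<Rightarrow> nat \<Rightarrow> (nat \<Rightarrow> 'ys) set) \<Rightarrow> bool"
  where
  "is_code \<omega> n M1 M2 Ls Ns \<epsilon> x1 x2 xs Dp Ds \<longleftrightarrow>
     1 \<le> M1 \<and> 1 \<le> M2 \<and> 1 \<le> Ls \<and> 1 \<le> Ns \<and>
     (\<forall>i\<in>{1..M1}. x1 i \<in> {..<n} \<rightarrow>\<^sub>E UNIV) \<and>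
     (\<forall>j\<in>{1..M2}. x2 j \<in> {..<n} \<rightarrow>\<^sub>E UNIV) \<and>
     (\<forall>k\<in>{1..Ls}. \<forall>l\<in>{1..Ns}. xs k l \<in> {..<n} \<rightarrow>\<^sub>E UNIV) \<and>
     (\<forall>i\<in>{1..M1}. \<forall>j\<in>{1..M2}. \<forall>l\<in>{1..Ns}. Dp i j l \<subseteq> ({..<n} \<rightarrow>\<^sub>E UNIV)) \<and>
     disjoint_family_on (\<lambda>(i, j, l). Dp i j l) ({1..M1} \<times> {1..M2} \<times> {1..Ns}) \<and>
     (\<forall>k\<in>{1..Ls}. \<forall>l\<in>{1..Ns}. Ds k l \<subseteq> ({..<n} \<rightarrow>\<^sub>E UNIV)) \<and>
     disjoint_family_on (\<lambda>(k, l). Ds k l) ({1..Ls} \<times> {1..Ns}) \<and>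
     1 / (real M1 * real M2 * real Ls * real Ns) *
       (\<Sum>i=1..M1. \<Sum>j=1..M2. \<Sum>k=1..Ls. \<Sum>l=1..Ns.
          measure_pmf.prob (memoryless n (marg_p \<omega>) (x1 i) (x2 j) (xs k l)) {y. y \<notin> Dp i j l}) \<le> \<epsilon> \<and>
     1 / (real M1 * real M2 * real Ls * real Ns) *
       (\<Sum>i=1..M1. \<Sum>j=1..M2. \<Sum>k=1..Ls. \<Sum>l=1..Ns.
          measure_pmf.prob (memoryless n (marg_s \<omega>) (x1 i) (x2 j) (xs k l)) {y. y \<notin> Ds k l}) \<le> \<epsilon>"

text \<open>Here \<open>b\<close> is the base of all logarithms.\<close>

definition achievable ::
  "real \<Rightarrow> ('x1 \<Rightarrow> 'x2 \<Rightarrow> 'xs \<Rightarrow> ('yp \<times> 'ys) pmf) \<Rightarrow> real \<Rightarrow> real \<Rightarrow> real \<Rightarrow> real \<Rightarrow> bool"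
  where
  "achievable b \<omega> R1 R2 S T \<longleftrightarrow>
     0 \<le> R1 \<and> 0 \<le> R2 \<and> 0 \<le> S \<and> 0 \<le> T \<and>
     (\<forall>\<eta>>0. \<forall>\<epsilon>. 0 < \<epsilon> \<and> \<epsilon> < 1 \<longrightarrow>
        (\<forall>\<^sub>F n in sequentially. \<exists>M1 M2 Ls Ns x1 x2 xs Dp Ds.
           is_code \<omega> n M1 M2 Ls Ns \<epsilon> x1 x2 xs Dp Ds \<and>
           1 / real n * log b (real M1) \<ge> R1 - \<eta> \<and>
           1 / real n * log b (real M2) \<ge> R2 - \<eta> \<and>
           1 / real n * log b (real Ls) \<ge> S - \<eta> \<and>
           1 / real n * log b (real Ns) \<ge> T - \<eta>))"

text \<open>
  A tuple \<open>Q U W X1 X2 Xs Yp Ys\<close> of random variables is given by its joint distribution, on the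
  sample space of all possible outcomes; the random variables are the selectors. The finite ranges
  of \<open>Q\<close>, \<open>U\<close>, \<open>W\<close> may be any finite sets, so up to relabelling they are finite sets of natural
  numbers, and finiteness amounts to finite support of the joint distribution.
\<close>

datatype ('x1, 'x2, 'xs, 'yp, 'ys) outcome =
  Outcome (rvQ: nat) (rvU: nat) (rvW: nat) (rvX1: 'x1) (rvX2: 'x2) (rvXs: 'xs) (rvYp: 'yp) (rvYs: 'ys)

definition P_star ::
  "('x1 \<Rightarrow> 'x2 \<Rightarrow> 'xs \<Rightarrow> ('yp \<times> 'ys) pmf) \<Rightarrow> ('x1, 'x2, 'xs, 'yp, 'ys) outcome pmf set"
  where
  "P_star \<omega> = {Z.
     finite (set_pmf Z) \<and>
     (\<forall>q \<in> rvQ ` set_pmf Z. let Zq = cond_pmf Z {z. rvQ z = q} in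
        map_pmf (\<lambda>z. (rvX1 z, rvX2 z, rvU z, rvW z)) Zq =
        pair_pmf (map_pmf rvX1 Zq) (pair_pmf (map_pmf rvX2 Zq)
          (pair_pmf (map_pmf rvU Zq) (map_pmf rvW Zq)))) \<and>
     (\<exists>f. \<forall>z \<in> set_pmf Z. rvXs z = f (rvU z) (rvW z) (rvQ z)) \<and>
     (\<forall>z \<in> set_pmf Z.
        map_pmf (\<lambda>z'. (rvYp z', rvYs z'))
          (cond_pmf Z {z'. rvQ z' = rvQ z \<and> rvU z' = rvU z \<and> rvW z' = rvW z \<and>
             rvX1 z' = rvX1 z \<and> rvX2 z' = rvX2 z \<and> rvXs z' = rvXs z}) =
        \<omega> (rvX1 z) (rvX2 z) (rvXs z))}"

text \<open>
  The library definition pairs \<open>B\<close> and \<open>C\<close>; the product of two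
  counting spaces is again a counting space since all ranges used below are countable. The targets
  are \<open>count_space UNIV\<close> because the selectors have infinite range on the whole sample space, only
  their range on the support being finite.
\<close>

definition cond_info :: "real \<Rightarrow> 'o pmf \<Rightarrow> ('o \<Rightarrow> 'a) \<Rightarrow> ('o \<Rightarrow> 'b) \<Rightarrow> ('o \<Rightarrow> 'c) \<Rightarrow> real"
  where
  "cond_info b Z A B C = prob_space.conditional_mutual_information (measure_pmf Z) b
     (count_space UNIV) (count_space UNIV) (count_space UNIV) A B C"

definition rate_region :: "real \<Rightarrow> ('x1, 'x2, 'xs, 'yp, 'ys) outcome pmf \<Rightarrow> (real \<times> real) set"
  where
  "rate_region b Z = {(S + T, R1 + R2) | R1 R2 S T.
     0 \<le> R1 \<and> 0 \<le> R2 \<and> 0 \<le> S \<and> 0 \<le> T \<and>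
     R1 \<le> cond_info b Z rvYp rvX1 (\<lambda>z. (rvW z, rvX2 z, rvQ z)) \<and>
     R2 \<le> cond_info b Z rvYp rvX2 (\<lambda>z. (rvW z, rvX1 z, rvQ z)) \<and>
     T \<le> cond_info b Z rvYp rvW (\<lambda>z. (rvX1 z, rvX2 z, rvQ z)) \<and>
     R1 + R2 \<le> cond_info b Z rvYp (\<lambda>z. (rvX1 z, rvX2 z)) (\<lambda>z. (rvW z, rvQ z)) \<and>
     T + R1 \<le> cond_info b Z rvYp (\<lambda>z. (rvW z, rvX1 z)) (\<lambda>z. (rvX2 z, rvQ z)) \<and>
     T + R2 \<le> cond_info b Z rvYp (\<lambda>z. (rvW z, rvX2 z)) (\<lambda>z. (rvX1 z, rvQ z)) \<and>
     T + R1 + R2 \<le> cond_info b Z rvYp (\<lambda>z. (rvW z, rvX1 z, rvX2 z)) rvQ \<and>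
     S \<le> cond_info b Z rvYs rvU (\<lambda>z. (rvW z, rvQ z)) \<and>
     T \<le> cond_info b Z rvYs rvW (\<lambda>z. (rvU z, rvQ z)) \<and>
     S + T \<le> cond_info b Z rvYs (\<lambda>z. (rvU z, rvW z)) rvQ}"

definition inner_region ::
  "real \<Rightarrow> ('x1 \<Rightarrow> 'x2 \<Rightarrow> 'xs \<Rightarrow> ('yp \<times> 'ys) pmf) \<Rightarrow> (real \<times> real) set"
  where "inner_region b \<omega> = closure (\<Union>Z \<in> P_star \<omega>. rate_region b Z)"

end

theory Submission
  imports Defs
begin

text \<open>
  Random coding with time sharing. The four codebooks are drawn letterwise from the conditional
  laws given \<open>Q\<close>, and \<open>X\<^sub>s\<close> is computed from the \<open>U\<close>- and \<open>W\<close>-codewords. A receiver accepts a message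
  tuple if, for every nonempty set \<open>A\<close> of the users it decodes, the product of the information
  densities between its output and the codewords of \<open>A\<close> given the remaining decoded codewords
  exceeds \<open>b powr (n (I - \<delta>))\<close>, \<open>I\<close> being the corresponding conditional mutual information. The sent
  tuple passes by the law of large numbers. A tuple that is wrong exactly on \<open>A\<close> passes with probability
  at most \<open>b powr (- n (I - \<delta>))\<close>, because a density has mean at most 1 under the law with independent
  codewords; the rate constraint on \<open>A\<close> beats the number of such tuples. The average error of both
  receivers over the random codebook tends to 0, so some codebook is good for both. Achievable
  tuples form a closed set, and compactness carries the splitting of the rates through the closure.
\<close>

section \<open>Information densities\<close>

text \<open>
  The information density is kept as a ratio because off the support it is 0, where its logarithm
  would take the junk value \<open>log b 0 = 0\<close>.
\<close>

definition info_ratio ::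
  "'o pmf \<Rightarrow> ('o \<Rightarrow> 'a) \<Rightarrow> ('o \<Rightarrow> 'b) \<Rightarrow> ('o \<Rightarrow> 'c) \<Rightarrow> 'a \<times> 'b \<times> 'c \<Rightarrow> real"
  where "info_ratio Z A B C = (\<lambda>(a, b, c).
    pmf (map_pmf (\<lambda>z. (A z, B z, C z)) Z) (a, b, c) * pmf (map_pmf C Z) c /
    (pmf (map_pmf (\<lambda>z. (A z, C z)) Z) (a, c) * pmf (map_pmf (\<lambda>z. (B z, C z)) Z) (b, c)))"

definition cinfo :: "real \<Rightarrow> 'o pmf \<Rightarrow> ('o \<Rightarrow> 'a) \<Rightarrow> ('o \<Rightarrow> 'b) \<Rightarrow> ('o \<Rightarrow> 'c) \<Rightarrow> real"
  where "cinfo b Z A B C =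
    measure_pmf.expectation Z (\<lambda>z. log b (info_ratio Z A B C (A z, B z, C z)))"

lemma info_ratio_nonneg: "0 \<le> info_ratio Z A B C s"
  by (cases s) (simp add: info_ratio_def)

lemma info_ratio_pos: "z \<in> set_pmf Z \<Longrightarrow> 0 < info_ratio Z A B C (A z, B z, C z)"
  by (auto simp: info_ratio_def pmf_positive)

section \<open>Conditional mutual information as the mean of a log density\<close>

lemma distributed_pmf:
  "distributed (measure_pmf Z) (count_space UNIV) X (\<lambda>x. ennreal (pmf (map_pmf X Z) x))"
  unfolding distributed_def
  by (simp add: map_pmf_rep_eq[symmetric] measure_pmf_eq_density[symmetric])

lemma integrable_count_space_pmf:
  assumes "finite (set_pmf W)"
  shows "integrable (count_space UNIV) (\<lambda>s. pmf W s * (f s :: real))"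
  using integrable_measure_pmf_finite[OF assms, of f] unfolding measure_pmf_eq_density
  by (subst (asm) integrable_density) auto

lemma integral_count_space_pmf:
  "(\<integral>s. pmf W s * f s \<partial>count_space UNIV) = measure_pmf.expectation W f" for f :: "_ \<Rightarrow> real"
  unfolding measure_pmf_eq_density by (subst integral_density) auto

text \<open>The law of large numbers needs the information as a mean under \<open>Z\<close>.
  Countable ranges make the products of counting spaces counting spaces again, and finite support
  gives the integrability conditions.\<close>

lemma cond_info_eq_cinfo:
  fixes A :: "'o \<Rightarrow> 'a::countable" and B :: "'o \<Rightarrow> 'b::countable" and C :: "'o \<Rightarrow> 'c::countable"
  assumes b: "1 < b" and fin: "finite (set_pmf Z)"
  shows "cond_info b Z A B C = cinfo b Z A B C"
proof -
  interpret information_space "measure_pmf Z" b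
    using b by unfold_locales
  have sf: "sigma_finite_measure (count_space (UNIV :: 'a set))"
    "sigma_finite_measure (count_space (UNIV :: 'b set))"
    "sigma_finite_measure (count_space (UNIV :: 'c set))"
    by (simp_all add: sigma_finite_measure_count_space)
  have prod: "count_space (UNIV :: 'b set) \<Otimes>\<^sub>M count_space (UNIV :: 'c set) = count_space UNIV"
    "count_space (UNIV :: 'a set) \<Otimes>\<^sub>M count_space (UNIV :: 'c set) = count_space UNIV"
    "count_space (UNIV :: 'a set) \<Otimes>\<^sub>M count_space (UNIV :: ('b \<times> 'c) set) = count_space UNIV"
    by (simp_all add: pair_measure_countable)
  let ?W = "map_pmf (\<lambda>z. (A z, B z, C z)) Z"
  have int: "integrable (count_space UNIV) (\<lambda>(x, y, z). pmf ?W (x, y, z) * f x y z)" for f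
    using integrable_count_space_pmf[of ?W "\<lambda>(x, y, z). f x y z"] fin
    by (simp add: case_prod_unfold)
  have "cond_info b Z A B C =
    (\<integral>(x, y, z). pmf ?W (x, y, z) * log b (pmf ?W (x, y, z) / (pmf (map_pmf (\<lambda>z. (A z, C z)) Z) (x, z)
      * (pmf (map_pmf (\<lambda>z. (B z, C z)) Z) (y, z) / pmf (map_pmf C Z) z))) \<partial>count_space UNIV)"
    unfolding cond_info_def
    by (subst conditional_mutual_information_generic_eq[OF sf,
          where Px = "pmf (map_pmf A Z)" and Pz = "pmf (map_pmf C Z)" and
          Pyz = "pmf (map_pmf (\<lambda>z. (B z, C z)) Z)" and
          Pxz = "pmf (map_pmf (\<lambda>z. (A z, C z)) Z)" and Pxyz = "pmf ?W"])
       (simp_all add: prod distributed_pmf int)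
  also have "\<dots> = (\<integral>s. pmf ?W s * log b (info_ratio Z A B C s) \<partial>count_space UNIV)"
    by (simp add: info_ratio_def case_prod_unfold)
  also have "\<dots> = cinfo b Z A B C"
    unfolding integral_count_space_pmf cinfo_def by simp
  finally show ?thesis .
qed

lemma pmf_map_cong_fibre:
  assumes "z \<in> set_pmf Z" "\<And>z'. z' \<in> set_pmf Z \<Longrightarrow> A' (g z') = A' (g z) \<longleftrightarrow> A z' = A z"
  shows "pmf (map_pmf A' (map_pmf g Z)) (A' (g z)) = pmf (map_pmf A Z) (A z)"
  unfolding pmf_map map_pmf_comp
  using assms by (intro measure_pmf.finite_measure_eq_AE) (auto simp: AE_measure_pmf_iff)

text \<open>At points of the support a density depends only on the partitions of the support that
  the variables induce. Letters indexed by sets of users can thus replace tuples of random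
  variables.\<close>

lemma cinfo_relabel:
  assumes A: "\<And>z z'. z \<in> set_pmf Z \<Longrightarrow> z' \<in> set_pmf Z \<Longrightarrow> A' (g z') = A' (g z) \<longleftrightarrow> A z' = A z"
    and B: "\<And>z z'. z \<in> set_pmf Z \<Longrightarrow> z' \<in> set_pmf Z \<Longrightarrow> B' (g z') = B' (g z) \<longleftrightarrow> B z' = B z"
    and C: "\<And>z z'. z \<in> set_pmf Z \<Longrightarrow> z' \<in> set_pmf Z \<Longrightarrow> C' (g z') = C' (g z) \<longleftrightarrow> C z' = C z"
  shows "cinfo b (map_pmf g Z) A' B' C' = cinfo b Z A B C"
proof -
  have "info_ratio (map_pmf g Z) A' B' C' (A' (g z), B' (g z), C' (g z)) =
      info_ratio Z A B C (A z, B z, C z)" if z: "z \<in> set_pmf Z" for z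
    using pmf_map_cong_fibre[OF z, of C' g C]
      pmf_map_cong_fibre[OF z, of "\<lambda>z. (A' z, C' z)" g "\<lambda>z. (A z, C z)"]
      pmf_map_cong_fibre[OF z, of "\<lambda>z. (B' z, C' z)" g "\<lambda>z. (B z, C z)"]
      pmf_map_cong_fibre[OF z, of "\<lambda>z. (A' z, B' z, C' z)" g "\<lambda>z. (A z, B z, C z)"]
      A[OF z] B[OF z] C[OF z]
    by (simp add: info_ratio_def)
  then show ?thesis
    unfolding cinfo_def by (auto intro!: integral_cong_AE simp: AE_measure_pmf_iff)
qed

text \<open>
  Change of measure: the law \<open>R\<close> makes \<open>A\<close> and \<open>B\<close> independent given \<open>C\<close> with the marginals of \<open>Z\<close>,
  so the ratio is the density of \<open>Z\<close> with respect to \<open>R\<close>.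
\<close>

lemma expectation_info_ratio_le_1:
  assumes fin: "finite (set_pmf R)"
    and R: "R = do {(a, c) \<leftarrow> map_pmf (\<lambda>z. (A z, C z)) Z; b \<leftarrow> K c; return_pmf (a, b, c)}"
    and BC: "map_pmf (\<lambda>z. (B z, C z)) Z = do {c \<leftarrow> map_pmf C Z; b \<leftarrow> K c; return_pmf (b, c)}"
  shows "measure_pmf.expectation R (info_ratio Z A B C) \<le> 1"
proof -
  have pmf_BC: "pmf (map_pmf (\<lambda>z. (B z, C z)) Z) (b, c) = pmf (map_pmf C Z) c * pmf (K c) b" for b c
  proof -
    have "map_pmf (\<lambda>z. (B z, C z)) Z = map_pmf prod.swap (bind_pmf (map_pmf C Z) (\<lambda>c. map_pmf (Pair c) (K c)))"
      unfolding BC by (simp add: map_bind_pmf map_pmf_def[symmetric] pmf.map_comp o_def)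
    then have "pmf (map_pmf (\<lambda>z. (B z, C z)) Z) (prod.swap (c, b)) =
        pmf (bind_pmf (map_pmf C Z) (\<lambda>c. map_pmf (Pair c) (K c))) (c, b)"
      by (metis pmf_map_inj' swap_inj_on inj_swap)
    also have "\<dots> = measure_pmf.expectation (map_pmf C Z) (\<lambda>c'. pmf (K c) b * indicator {c} c')"
      unfolding pmf_bind
    proof (intro integral_cong_AE)
      show "AE c' in map_pmf C Z. pmf (map_pmf (Pair c') (K c')) (c, b) = pmf (K c) b * indicator {c} c'"
      proof (intro AE_I2)
        fix c'
        show "pmf (map_pmf (Pair c') (K c')) (c, b) = pmf (K c) b * indicator {c} c'"
        proof (cases "c' = c")
          case True
          then show ?thesis by (simp add: pmf_map_inj' inj_on_def)
        next
          case False
          then show ?thesis by (auto intro!: pmf_map_outside)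
        qed
      qed
    qed auto
    also have "\<dots> = pmf (map_pmf C Z) c * pmf (K c) b"
      by (simp only: integral_mult_right_zero) (simp add: measure_pmf_single)
    finally show ?thesis by simp
  qed
  have pmf_R: "pmf R (a, b, c) = pmf (map_pmf (\<lambda>z. (A z, C z)) Z) (a, c) * pmf (K c) b" for a b c
  proof -
    let ?AC = "map_pmf (\<lambda>z. (A z, C z)) Z"
    let ?f = "\<lambda>((a, c), b). (a, b, c)"
    have inj: "inj ?f" by (auto simp: inj_on_def)
    have "R = map_pmf ?f (bind_pmf ?AC (\<lambda>ac. map_pmf (Pair ac) (K (snd ac))))"
      unfolding R by (simp add: map_bind_pmf map_pmf_def[symmetric] pmf.map_comp o_def case_prod_unfold)
    then have "pmf R (?f ((a, c), b)) = pmf (bind_pmf ?AC (\<lambda>ac. map_pmf (Pair ac) (K (snd ac)))) ((a, c), b)"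
      by (simp only: pmf_map_inj'[OF inj])
    also have "\<dots> = measure_pmf.expectation ?AC (\<lambda>ac. pmf (K c) b * indicator {(a, c)} ac)"
      unfolding pmf_bind
    proof (intro integral_cong_AE)
      show "AE ac in ?AC. pmf (map_pmf (Pair ac) (K (snd ac))) ((a, c), b) = pmf (K c) b * indicator {(a, c)} ac"
      proof (intro AE_I2)
        fix ac
        show "pmf (map_pmf (Pair ac) (K (snd ac))) ((a, c), b) = pmf (K c) b * indicator {(a, c)} ac"
        proof (cases "ac = (a, c)")
          case True
          then show ?thesis by (simp add: pmf_map_inj' inj_on_def)
        next
          case False
          then show ?thesis by (auto intro!: pmf_map_outside)
        qed
      qed
    qed auto
    also have "\<dots> = pmf ?AC (a, c) * pmf (K c) b"
      by (simp only: integral_mult_right_zero) (simp add: measure_pmf_single)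
    finally show ?thesis by simp
  qed
  let ?W = "map_pmf (\<lambda>z. (A z, B z, C z)) Z"
  have "measure_pmf.expectation R (info_ratio Z A B C) = (\<Sum>s\<in>set_pmf R. info_ratio Z A B C s * pmf R s)"
    using fin by (intro integral_measure_pmf_real) auto
  \<comment> \<open>The denominator of the ratio is \<open>pmf R s\<close> times the mass of
    \<open>c\<close>, and the numerator carries that mass too. Each summand collapses to a mass of
    the true joint law.\<close>
  also have "\<dots> \<le> (\<Sum>s\<in>set_pmf R. pmf ?W s)"
  proof (intro sum_mono)
    fix s assume s: "s \<in> set_pmf R"
    obtain a b c where abc: "s = (a, b, c)" by (cases s)
    have "pmf (map_pmf (\<lambda>z. (A z, C z)) Z) (a, c) * pmf (K c) b \<noteq> 0"
      using s unfolding abc by (simp add: set_pmf_eq pmf_R[symmetric])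
    then show "info_ratio Z A B C s * pmf R s \<le> pmf ?W s"
      by (simp add: abc info_ratio_def pmf_R pmf_BC)
  qed
  also have "\<dots> = measure_pmf.prob ?W (set_pmf R)"
    using fin by (rule measure_measure_pmf_finite[symmetric])
  also have "\<dots> \<le> 1" by simp
  finally show ?thesis .
qed

section \<open>Tail bounds for products of i.i.d. densities\<close>

lemma finite_set_Pi_pmf:
  "finite A \<Longrightarrow> (\<And>x. x \<in> A \<Longrightarrow> finite (set_pmf (p x))) \<Longrightarrow> finite (set_pmf (Pi_pmf A d p))"
  by (simp add: set_Pi_pmf finite_PiE_dflt)

text \<open>Markov's inequality: by independence the mean of the product is the \<open>n\<close>-th
  power of the single-letter mean, hence at most 1.\<close>

lemma iid_ratio_tail:
  fixes r :: "'s \<Rightarrow> real" and n :: nat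
  assumes fin: "finite (set_pmf R)" and nn: "\<And>s. 0 \<le> r s"
    and le1: "measure_pmf.expectation R r \<le> 1" and \<theta>: "0 < \<theta>"
  shows "measure_pmf.prob (Pi_pmf {..<n} d (\<lambda>_. R)) {s. \<theta> < (\<Prod>t<n. r (s t))} \<le> 1 / \<theta>"
proof -
  let ?P = "Pi_pmf {..<n} d (\<lambda>_. R)"
  have finP: "finite (set_pmf ?P)" using fin by (intro finite_set_Pi_pmf) auto
  have "measure_pmf.prob ?P {s. \<theta> < (\<Prod>t<n. r (s t))} =
      measure_pmf.expectation ?P (indicator {s. \<theta> < (\<Prod>t<n. r (s t))})" by simp
  also have "\<dots> \<le> measure_pmf.expectation ?P (\<lambda>s. (\<Prod>t<n. r (s t)) / \<theta>)"
    using \<theta> by (intro integral_mono integrable_measure_pmf_finite finP)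
      (auto simp: indicator_def field_simps intro!: prod_nonneg nn)
  also have "\<dots> = (\<Prod>t<n. measure_pmf.expectation R r) / \<theta>"
    using expectation_prod_Pi_pmf[of "{..<n}" "\<lambda>_. R" "\<lambda>_. r" d] fin nn
    by (simp add: integrable_measure_pmf_finite)
  also have "\<dots> \<le> 1 / \<theta>"
    using \<theta> le1 nn by (intro divide_right_mono) (auto intro!: power_le_one integral_nonneg_AE)
  finally show ?thesis .
qed

text \<open>Finite support bounds \<open>g\<close>, so Hoeffding's inequality applies; the decay is
  even exponential.\<close>

lemma iid_sum_lower_tail:
  fixes g :: "'s \<Rightarrow> real"
  assumes fin: "finite (set_pmf J)" and \<delta>: "0 < \<delta>"
  shows "(\<lambda>n. measure_pmf.prob (Pi_pmf {..<n} d (\<lambda>_. J))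
    {s. (\<Sum>t<n. g (s t)) \<le> real n * (measure_pmf.expectation J g - \<delta>)}) \<longlonglongrightarrow> 0"
proof -
  \<comment> \<open>The summand 1 keeps \<open>B\<close> positive, so the Hoeffding exponent has a
    nonzero denominator.\<close>
  define B where "B = 1 + Max ((\<lambda>s. \<bar>g s\<bar>) ` set_pmf J)"
  have B: "\<bar>g s\<bar> \<le> B" if "s \<in> set_pmf J" for s
    using that fin unfolding B_def by (simp add: add_increasing)
  obtain s0 where "s0 \<in> set_pmf J" using set_pmf_not_empty[of J] by blast
  then have "\<bar>g s0\<bar> \<le> Max ((\<lambda>s. \<bar>g s\<bar>) ` set_pmf J)" using fin by simp
  then have "0 < B" unfolding B_def by linarith
  \<comment> \<open>With intervals of length 2B in each of n letters, Hoeffding's exponent has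
    numerator \<open>2 * (n * \<delta>)\<^sup>2\<close> and denominator
    \<open>n * (2 * B)\<^sup>2\<close>, which is n times this constant.\<close>
  let ?c = "2 * \<delta>\<^sup>2 / (2 * B)\<^sup>2"
  have c: "0 < ?c" using \<delta> \<open>0 < B\<close> by simp
  have bound: "measure_pmf.prob (Pi_pmf {..<n} d (\<lambda>_. J))
      {s. (\<Sum>t<n. g (s t)) \<le> real n * (measure_pmf.expectation J g - \<delta>)} \<le> exp (- ?c) ^ n"
    if n: "0 < n" for n
  proof -
    let ?P = "Pi_pmf {..<n} d (\<lambda>_. J)"
    have E: "measure_pmf.expectation ?P (\<lambda>s. g (s t)) = measure_pmf.expectation J g" if "t < n" for t
    proof -
      have "measure_pmf.expectation ?P (\<lambda>s. g (s t)) = measure_pmf.expectation (map_pmf (\<lambda>s. s t) ?P) g"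
        by simp
      also have "map_pmf (\<lambda>s. s t) ?P = J" using that by (subst Pi_pmf_component) auto
      finally show ?thesis .
    qed
    interpret H: Hoeffding_ineq "measure_pmf ?P" "{..<n}" "\<lambda>t s. g (s t)" "\<lambda>_. -B" "\<lambda>_. B"
      "\<Sum>t<n. measure_pmf.expectation ?P (\<lambda>s. g (s t))"
    proof unfold_locales
      show "prob_space.indep_vars (measure_pmf ?P) (\<lambda>_. borel) (\<lambda>t s. g (s t)) {..<n}"
        using prob_space.indep_vars_compose2[OF measure_pmf.prob_space_axioms indep_vars_Pi_pmf, of "{..<n}" "\<lambda>_. g" "\<lambda>_. borel"]
        by simp
      show "AE x in ?P. g (x t) \<in> {- B..B}" if "t \<in> {..<n}" for t
      proof (rule AE_pmfI)
        fix x assume "x \<in> set_pmf ?P"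
        then have "x t \<in> set_pmf J" using that by (auto simp: set_Pi_pmf PiE_dflt_def)
        from B[OF this] show "g (x t) \<in> {- B..B}" by auto
      qed
    qed auto
    have "measure_pmf.prob ?P {x \<in> space ?P. (\<Sum>t<n. g (x t)) \<le>
        (\<Sum>t<n. measure_pmf.expectation ?P (\<lambda>s. g (s t))) - real n * \<delta>}
        \<le> exp (-2 * (real n * \<delta>)\<^sup>2 / (\<Sum>t<n. (B - - B)\<^sup>2))"
      by (rule H.Hoeffding_ineq_le) (use \<delta> n \<open>0 < B\<close> in auto)
    also have "(\<Sum>t<n. measure_pmf.expectation ?P (\<lambda>s. g (s t))) - real n * \<delta> =
        real n * (measure_pmf.expectation J g - \<delta>)"
      using E by (simp add: algebra_simps)
    also have "-2 * (real n * \<delta>)\<^sup>2 / (\<Sum>t<n. (B - - B)\<^sup>2) = real n * (- ?c)"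
      using n \<open>0 < B\<close> by (simp add: power2_eq_square field_simps)
    finally show ?thesis by (simp only: exp_of_nat_mult space_measure_pmf UNIV_I simp_thms)
  qed
  have lim: "(\<lambda>n. exp (- ?c) ^ n) \<longlonglongrightarrow> 0"
    using c by (intro LIMSEQ_power_zero) simp
  show ?thesis
    by (rule tendsto_sandwich[OF _ eventually_mono[OF eventually_gt_at_top[of 0] bound] tendsto_const lim]) auto
qed

text \<open>After taking logarithms this is the lower tail of a sum. The events are compared only
  almost surely, because \<open>r\<close> is known to be positive only on the support of
  \<open>J\<close>.\<close>

lemma iid_ratio_lower_tail:
  fixes r :: "'s \<Rightarrow> real"
  assumes fin: "finite (set_pmf J)" and pos: "\<And>s. s \<in> set_pmf J \<Longrightarrow> 0 < r s"
    and b: "1 < b" and \<delta>: "0 < \<delta>"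
  shows "(\<lambda>n. measure_pmf.prob (Pi_pmf {..<n} d (\<lambda>_. J))
    {s. (\<Prod>t<n. r (s t)) \<le> b powr (real n * (measure_pmf.expectation J (\<lambda>s. log b (r s)) - \<delta>))})
    \<longlonglongrightarrow> 0"
proof (rule tendsto_sandwich[OF _ _ tendsto_const iid_sum_lower_tail[OF fin \<delta>, of d "\<lambda>s. log b (r s)"]])
  show "\<forall>\<^sub>F n in sequentially. measure_pmf.prob (Pi_pmf {..<n} d (\<lambda>_. J))
    {s. (\<Prod>t<n. r (s t)) \<le> b powr (real n * (measure_pmf.expectation J (\<lambda>s. log b (r s)) - \<delta>))}
    \<le> measure_pmf.prob (Pi_pmf {..<n} d (\<lambda>_. J))
    {s. (\<Sum>t<n. log b (r (s t))) \<le> real n * (measure_pmf.expectation J (\<lambda>s. log b (r s)) - \<delta>)}"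
  proof (intro always_eventually allI, rule measure_pmf.finite_measure_mono_AE, intro AE_pmfI impI)
    fix n s assume s: "s \<in> set_pmf (Pi_pmf {..<n} d (\<lambda>_. J))"
      and *: "s \<in> {s. (\<Prod>t<n. r (s t)) \<le> b powr (real n * (measure_pmf.expectation J (\<lambda>s. log b (r s)) - \<delta>))}"
    have p: "0 < r (s t)" if "t < n" for t
      using s that by (intro pos) (auto simp: set_Pi_pmf PiE_dflt_def)
    have "0 < (\<Prod>t<n. r (s t))" using p by (intro prod_pos) auto
    then have "log b (\<Prod>t<n. r (s t)) \<le> real n * (measure_pmf.expectation J (\<lambda>s. log b (r s)) - \<delta>)"
      using * b by (simp add: log_le_iff)
    moreover have "log b (\<Prod>t<n. r (s t)) = (\<Sum>t<n. log b (r (s t)))"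
      using ln_prod[of "{..<n}" "\<lambda>t. r (s t)"] p by (force simp: log_def sum_divide_distrib)
    ultimately show "s \<in> {s. (\<Sum>t<n. log b (r (s t))) \<le> real n * (measure_pmf.expectation J (\<lambda>s. log b (r s)) - \<delta>)}"
      by simp
  qed auto
qed auto

section \<open>Random coding for a multiple access channel\<close>

lemma measure_bind_pmf:
  "measure (measure_pmf (bind_pmf M N)) X = measure_pmf.expectation M (\<lambda>x. measure (measure_pmf (N x)) X)"
proof -
  have "ennreal (measure (measure_pmf (bind_pmf M N)) X) =
      (\<integral>\<^sup>+x. ennreal (measure (measure_pmf (N x)) X) \<partial>M)"
    by (simp add: measure_pmf.emeasure_eq_measure[symmetric])
  also have "\<dots> = ennreal (measure_pmf.expectation M (\<lambda>x. measure (measure_pmf (N x)) X))"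
    by (intro nn_integral_eq_integral measure_pmf.integrable_const_bound[where B = 1]) auto
  finally show ?thesis
    by (subst (asm) ennreal_inj) (auto intro!: integral_nonneg_AE)
qed

text \<open>Injectivity makes the coordinates \<open>h j\<close> distinct, so they stay independent.
  The codewords of a message tuple are read off the codebook in this way, one table entry per
  user.\<close>

lemma Pi_pmf_reindex:
  assumes I: "finite I" and inj: "inj_on h J" and hJ: "h ` J \<subseteq> I"
  shows "map_pmf (\<lambda>c. \<lambda>j\<in>J. c (h j)) (Pi_pmf I d P) = Pi_pmf J undefined (\<lambda>j. P (h j))"
proof (rule pmf_eqI)
  fix f
  have J: "finite J" using I inj hJ by (meson finite_imageD finite_subset)
  show "pmf (map_pmf (\<lambda>c. \<lambda>j\<in>J. c (h j)) (Pi_pmf I d P)) f = pmf (Pi_pmf J undefined (\<lambda>j. P (h j))) f"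
  proof (cases "\<forall>j. j \<notin> J \<longrightarrow> f j = undefined")
    case True
    \<comment> \<open>The fibre over \<open>f\<close> is a box: coordinates in the image of
      \<open>h\<close> are pinned, all others are free.\<close>
    let ?B = "\<lambda>i. if i \<in> h ` J then {f (the_inv_into J h i)} else UNIV"
    have "(\<lambda>c. \<lambda>j\<in>J. c (h j)) -` {f} = Pi I ?B"
    proof (intro set_eqI iffI)
      fix c assume "c \<in> (\<lambda>c. \<lambda>j\<in>J. c (h j)) -` {f}"
      then have f: "f = (\<lambda>j\<in>J. c (h j))" by simp
      show "c \<in> Pi I ?B" unfolding f by (auto simp: the_inv_into_f_f[OF inj])
    next
      fix c assume c: "c \<in> Pi I ?B"
      have "c (h j) = f j" if "j \<in> J" for j
      proof -
        have "h j \<in> I" "h j \<in> h ` J" using that hJ by auto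
        with c have "c (h j) \<in> ?B (h j)" by blast
        then show ?thesis using that by (simp add: the_inv_into_f_f[OF inj])
      qed
      then show "c \<in> (\<lambda>c. \<lambda>j\<in>J. c (h j)) -` {f}" using True by (auto simp: fun_eq_iff)
    qed
    then have "pmf (map_pmf (\<lambda>c. \<lambda>j\<in>J. c (h j)) (Pi_pmf I d P)) f =
        (\<Prod>i\<in>I. measure_pmf.prob (P i) (?B i))"
      by (simp only: pmf_map measure_Pi_pmf_Pi[OF I])
    also have "\<dots> = (\<Prod>i\<in>h ` J. measure_pmf.prob (P i) (?B i))"
      using I hJ by (intro prod.mono_neutral_right) auto
    also have "\<dots> = (\<Prod>j\<in>J. pmf (P (h j)) (f j))"
      by (simp add: prod.reindex[OF inj] the_inv_into_f_f[OF inj] measure_pmf_single)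
    also have "\<dots> = pmf (Pi_pmf J undefined (\<lambda>j. P (h j))) f"
      using True J by (simp add: pmf_Pi)
    finally show ?thesis .
  next
    case False
    then have "(\<lambda>c. \<lambda>j\<in>J. c (h j)) -` {f} = {}" by (auto simp: fun_eq_iff)
    then show ?thesis using False J by (auto simp: pmf_map pmf_Pi)
  qed
qed

lemma Pi_pmf_restrict:
  "finite I \<Longrightarrow> J \<subseteq> I \<Longrightarrow> map_pmf (\<lambda>c. restrict c J) (Pi_pmf I d P) = Pi_pmf J undefined P"
  using Pi_pmf_reindex[of I "\<lambda>x. x" J d P] by simp

lemma Pi_pmf_restrict_pair:
  assumes I: "finite I" and sub: "I1 \<subseteq> I" "I2 \<subseteq> I" and disj: "I1 \<inter> I2 = {}"
  shows "map_pmf (\<lambda>c. (restrict c I1, restrict c I2)) (Pi_pmf I d P) =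
    pair_pmf (Pi_pmf I1 undefined P) (Pi_pmf I2 undefined P)"
proof -
  have fin: "finite I1" "finite I2" using I sub finite_subset by blast+
  have "map_pmf (\<lambda>c. (restrict c I1, restrict c I2)) (Pi_pmf I d P) =
      map_pmf (\<lambda>c. (restrict c I1, restrict c I2)) (map_pmf (\<lambda>c. restrict c (I1 \<union> I2)) (Pi_pmf I d P))"
    by (simp add: pmf.map_comp o_def Int_absorb1)
  also have "map_pmf (\<lambda>c. restrict c (I1 \<union> I2)) (Pi_pmf I d P) = Pi_pmf (I1 \<union> I2) undefined P"
    using I sub by (intro Pi_pmf_restrict) auto
  also have "\<dots> = map_pmf (\<lambda>(f,g) x. if x \<in> I1 then f x else g x)
      (pair_pmf (Pi_pmf I1 undefined P) (Pi_pmf I2 undefined P))"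
    by (intro Pi_pmf_union fin disj)
  also have "map_pmf (\<lambda>c. (restrict c I1, restrict c I2)) \<dots> =
      map_pmf (\<lambda>x. x) (pair_pmf (Pi_pmf I1 undefined P) (Pi_pmf I2 undefined P))"
    unfolding pmf.map_comp
  proof (rule map_pmf_cong[OF refl])
    fix fg assume "fg \<in> set_pmf (pair_pmf (Pi_pmf I1 undefined P) (Pi_pmf I2 undefined P))"
    moreover obtain f g where [simp]: "fg = (f, g)" by (cases fg)
    ultimately have "\<forall>x. x \<notin> I1 \<longrightarrow> f x = undefined" "\<forall>x. x \<notin> I2 \<longrightarrow> g x = undefined"
      using set_Pi_pmf_subset[OF fin(1), of undefined P] set_Pi_pmf_subset[OF fin(2), of undefined P]
      by auto
    then show "((\<lambda>c. (restrict c I1, restrict c I2)) \<circ> (\<lambda>(f, g) x. if x \<in> I1 then f x else g x)) fg = fg"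
      using disj by (auto simp: fun_eq_iff)
  qed
  finally show ?thesis unfolding map_pmf_ident .
qed

text \<open>The assumptions on \<open>F\<close> and \<open>G\<close> say that they read disjoint
  blocks of coordinates. They will be the codewords of a wrong and of the sent message
  tuple.\<close>

lemma map_pmf_restrict_apply:
  assumes I: "finite I" and sub: "I1 \<subseteq> I" "I2 \<subseteq> I" and disj: "I1 \<inter> I2 = {}"
    and F: "\<And>c. F (restrict c I1) = F c" and G: "\<And>c. G (restrict c I2) = G c"
  shows "map_pmf (\<lambda>c. (F c, G c)) (Pi_pmf I d P) =
    pair_pmf (map_pmf F (Pi_pmf I d P)) (map_pmf G (Pi_pmf I d P))"
proof -
  have 1: "map_pmf F (Pi_pmf I d P) = map_pmf F (Pi_pmf I1 undefined P)"
    unfolding Pi_pmf_restrict[OF I sub(1), symmetric, of _ d] by (simp add: pmf.map_comp o_def F)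
  have 2: "map_pmf G (Pi_pmf I d P) = map_pmf G (Pi_pmf I2 undefined P)"
    unfolding Pi_pmf_restrict[OF I sub(2), symmetric, of _ d] by (simp add: pmf.map_comp o_def G)
  have "map_pmf (\<lambda>c. (F c, G c)) (Pi_pmf I d P) =
      map_pmf (\<lambda>(f, g). (F f, G g)) (map_pmf (\<lambda>c. (restrict c I1, restrict c I2)) (Pi_pmf I d P))"
    by (simp add: pmf.map_comp o_def F G)
  also have "\<dots> = pair_pmf (map_pmf F (Pi_pmf I d P)) (map_pmf G (Pi_pmf I d P))"
    unfolding Pi_pmf_restrict_pair[OF I sub disj] 1 2 by (rule map_pair)
  finally show ?thesis .
qed

section \<open>Message tuples and their codewords\<close>

definition messages :: "('k \<Rightarrow> nat) \<Rightarrow> ('k \<Rightarrow> nat) set"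
  where "messages M = {m. \<forall>k. m k \<in> {1..M k}}"

definition codewords :: "('k \<times> nat \<Rightarrow> 'c) \<Rightarrow> ('k \<Rightarrow> nat) \<Rightarrow> 'k \<Rightarrow> 'c"
  where "codewords c m = (\<lambda>k. c (k, m k))"

lemma finite_messages: "finite (messages (M :: 'k::finite \<Rightarrow> nat))"
proof -
  have "messages M = PiE UNIV (\<lambda>k. {1..M k})" by (auto simp: messages_def PiE_def Pi_def)
  then show ?thesis by (simp add: finite_PiE)
qed

text \<open>Each user in \<open>A\<close> may take any index but the sent one, every other user is
  pinned. The exact count, with 1 subtracted, later absorbs the ceiling in the code sizes.\<close>

lemma card_messages_differing:
  fixes M :: "'k::finite \<Rightarrow> nat"
  assumes m: "m \<in> messages M"
  shows "card {m' \<in> messages M. {k. m' k \<noteq> m k} = A} = (\<Prod>k\<in>A. M k - 1)"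
proof -
  let ?F = "\<lambda>k. if k \<in> A then {1..M k} - {m k} else {m k}"
  have "{m' \<in> messages M. {k. m' k \<noteq> m k} = A} = PiE UNIV ?F"
  proof (intro set_eqI iffI)
    fix m' assume "m' \<in> PiE UNIV ?F"
    then have *: "m' k \<in> ?F k" for k by (rule PiE_mem) simp
    have "m' k \<in> {1..M k}" "m' k \<noteq> m k \<longleftrightarrow> k \<in> A" for k
      using *[of k] m by (auto simp: messages_def split: if_splits)
    then show "m' \<in> {m' \<in> messages M. {k. m' k \<noteq> m k} = A}" by (auto simp: messages_def)
  qed (auto simp: messages_def)
  then have "card {m' \<in> messages M. {k. m' k \<noteq> m k} = A} = (\<Prod>k\<in>UNIV. card (?F k))"
    by (simp add: card_PiE)
  also have "\<dots> = (\<Prod>k\<in>A. card (?F k))"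
    by (intro prod.mono_neutral_right) auto
  also have "\<dots> = (\<Prod>k\<in>A. M k - 1)"
    using m by (intro prod.cong) (auto simp: messages_def)
  finally show ?thesis .
qed

text \<open>
  The receiver decodes the users in \<open>D\<close> and treats the others as noise; \<open>q\<close> is the time-sharing
  letter, known to everybody.
\<close>

locale multiple_access =
  fixes b :: real
    and pQ :: "'q pmf" and p :: "'q \<Rightarrow> 'k::finite \<Rightarrow> 'c pmf"
    and v :: "'q \<Rightarrow> ('k \<Rightarrow> 'c) \<Rightarrow> 'y pmf"
    and D :: "'k set"
  assumes b: "1 < b"
    and finite_pQ: "finite (set_pmf pQ)"
    and finite_p: "q \<in> set_pmf pQ \<Longrightarrow> finite (set_pmf (p q k))"
    and finite_v: "finite (set_pmf (v q x))"
begin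

section \<open>Single-letter laws and densities\<close>

definition input :: "'q \<Rightarrow> ('k \<Rightarrow> 'c) pmf"
  where "input q = Pi_pmf UNIV undefined (p q)"

definition joint :: "('q \<times> ('k \<Rightarrow> 'c) \<times> 'y) pmf"
  where "joint = do {q \<leftarrow> pQ; x \<leftarrow> input q; y \<leftarrow> v q x; return_pmf (q, x, y)}"

definition out :: "'q \<times> ('k \<Rightarrow> 'c) \<times> 'y \<Rightarrow> 'y"
  where "out = (\<lambda>(q, x, y). y)"

text \<open>Restricted functions give all blocks of users the same type, so the densities for all
  sets \<open>A\<close> form one family.\<close>

definition unknown :: "'k set \<Rightarrow> 'q \<times> ('k \<Rightarrow> 'c) \<times> 'y \<Rightarrow> 'k \<Rightarrow> 'c"
  where "unknown A = (\<lambda>(q, x, y). restrict x A)"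

definition known :: "'k set \<Rightarrow> 'q \<times> ('k \<Rightarrow> 'c) \<times> 'y \<Rightarrow> ('k \<Rightarrow> 'c) \<times> 'q"
  where "known A = (\<lambda>(q, x, y). (restrict x (D - A), q))"

definition ratio :: "'k set \<Rightarrow> 'q \<times> ('k \<Rightarrow> 'c) \<times> 'y \<Rightarrow> real"
  where "ratio A s = info_ratio joint out (unknown A) (known A) (out s, unknown A s, known A s)"

definition info :: "'k set \<Rightarrow> real"
  where "info A = cinfo b joint out (unknown A) (known A)"

lemma info_altdef: "info A = measure_pmf.expectation joint (\<lambda>s. log b (ratio A s))"
  by (simp add: info_def cinfo_def ratio_def)

definition book :: "('k \<Rightarrow> nat) \<Rightarrow> 'q \<Rightarrow> ('k \<times> nat \<Rightarrow> 'c) pmf"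
  where "book M q = Pi_pmf (SIGMA k:UNIV. {1..M k}) undefined (\<lambda>(k, i). p q k)"

definition letter_book :: "('k \<Rightarrow> nat) \<Rightarrow> ('q \<times> ('k \<times> nat \<Rightarrow> 'c)) pmf"
  where "letter_book M = do {q \<leftarrow> pQ; c \<leftarrow> book M q; return_pmf (q, c)}"

lemma codewords_law:
  assumes "m \<in> messages M"
  shows "map_pmf (\<lambda>c. codewords c m) (book M q) = input q"
proof -
  have "map_pmf (\<lambda>c. \<lambda>k\<in>UNIV. c (k, m k)) (book M q) = Pi_pmf UNIV undefined (\<lambda>k. (\<lambda>(k, i). p q k) (k, m k))"
    unfolding book_def using assms by (intro Pi_pmf_reindex) (auto simp: inj_on_def messages_def)
  then show ?thesis by (simp add: codewords_def input_def restrict_UNIV)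
qed

text \<open>On \<open>A\<close> the two tuples use different table entries, so the wrong codewords
  there are independent of all codewords sent.\<close>

lemma codewords_pair_law:
  assumes m: "m \<in> messages M" "m' \<in> messages M"
  defines "A \<equiv> {k. m' k \<noteq> m k}"
  shows "map_pmf (\<lambda>c. (restrict (codewords c m') A, codewords c m)) (book M q) =
    pair_pmf (Pi_pmf A undefined (p q)) (input q)"
proof -
  let ?I = "SIGMA k:(UNIV :: 'k set). {1..M k}"
  let ?I1 = "(\<lambda>k. (k, m' k)) ` A" and ?I2 = "range (\<lambda>k. (k, m k))"
  have "map_pmf (\<lambda>c. (restrict (codewords c m') A, codewords c m)) (book M q) =
    pair_pmf (map_pmf (\<lambda>c. restrict (codewords c m') A) (book M q)) (map_pmf (\<lambda>c. codewords c m) (book M q))"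
    unfolding book_def
    by (rule map_pmf_restrict_apply[where ?I1.0 = ?I1 and ?I2.0 = ?I2])
       (use m in \<open>auto simp: messages_def A_def codewords_def fun_eq_iff\<close>)
  also have "map_pmf (\<lambda>c. restrict (codewords c m') A) (book M q) = Pi_pmf A undefined (p q)"
  proof -
    have "map_pmf (\<lambda>c. \<lambda>k\<in>A. c (k, m' k)) (book M q) = Pi_pmf A undefined (\<lambda>k. (\<lambda>(k, i). p q k) (k, m' k))"
      unfolding book_def using m by (intro Pi_pmf_reindex) (auto simp: inj_on_def messages_def)
    then show ?thesis by (simp add: codewords_def)
  qed
  also have "map_pmf (\<lambda>c. codewords c m) (book M q) = input q" by (rule codewords_law[OF m(1)])
  finally show ?thesis .
qed

text \<open>The output is caused by the message \<open>m\<close>, but observed together with the codewords of \<open>m'\<close>.\<close>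

definition letter :: "('k \<Rightarrow> nat) \<Rightarrow> ('k \<Rightarrow> nat) \<Rightarrow> ('k \<Rightarrow> nat) \<Rightarrow> ('q \<times> ('k \<Rightarrow> 'c) \<times> 'y) pmf"
  where "letter M m m' =
    do {(q, c) \<leftarrow> letter_book M; y \<leftarrow> v q (codewords c m); return_pmf (q, codewords c m', y)}"

lemma letter_same: "m \<in> messages M \<Longrightarrow> letter M m m = joint"
  unfolding letter_def letter_book_def joint_def codewords_law[symmetric]
  by (simp add: bind_assoc_pmf bind_return_pmf bind_map_pmf)

lemma finite_input: "q \<in> set_pmf pQ \<Longrightarrow> finite (set_pmf (input q))"
  unfolding input_def by (intro finite_set_Pi_pmf finite_p) auto

lemma finite_joint: "finite (set_pmf joint)"
  unfolding joint_def by (auto intro!: finite_input finite_pQ finite_v)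

lemma finite_letter_book: "finite (set_pmf (letter_book M))"
  proof -
  have "finite (set_pmf (book M q))" if "q \<in> set_pmf pQ" for q
    unfolding book_def using that by (intro finite_set_Pi_pmf) (auto intro: finite_p)
  then show ?thesis unfolding letter_book_def by (auto intro!: finite_pQ)
qed

lemma finite_letter: "finite (set_pmf (letter M m m'))"
  unfolding letter_def by (auto simp: case_prod_unfold intro!: finite_letter_book finite_v)

text \<open>Given \<open>q\<close> the users' letters are independent, so the law of the unknown
  block ignores the known block. This is the kernel demanded by the change of measure.\<close>

lemma unknown_known_law:
  assumes A: "A \<subseteq> D"
  shows "map_pmf (\<lambda>z. (unknown A z, known A z)) joint =
    do {c \<leftarrow> map_pmf (known A) joint; a \<leftarrow> Pi_pmf A undefined (p (snd c)); return_pmf (a, c)}"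
proof -
  have 1: "map_pmf (\<lambda>x. restrict x (D - A)) (input q) = Pi_pmf (D - A) undefined (p q)" for q
    unfolding input_def by (intro Pi_pmf_restrict) auto
  have 2: "map_pmf (\<lambda>x. (restrict x A, restrict x (D - A))) (input q) =
     pair_pmf (Pi_pmf A undefined (p q)) (Pi_pmf (D - A) undefined (p q))" for q
    unfolding input_def by (intro Pi_pmf_restrict_pair) auto
  have "map_pmf (\<lambda>z. (unknown A z, known A z)) joint =
      do {q \<leftarrow> pQ; (f, g) \<leftarrow> map_pmf (\<lambda>x. (restrict x A, restrict x (D - A))) (input q); return_pmf (f, (g, q))}"
    by (simp add: joint_def map_bind_pmf unknown_def known_def bind_map_pmf)
  also have "\<dots> = do {q \<leftarrow> pQ; f \<leftarrow> Pi_pmf A undefined (p q); g \<leftarrow> Pi_pmf (D - A) undefined (p q); return_pmf (f, (g, q))}"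
    unfolding 2 by (simp add: pair_pmf_def bind_assoc_pmf bind_return_pmf)
  also have "\<dots> = do {q \<leftarrow> pQ; g \<leftarrow> Pi_pmf (D - A) undefined (p q); f \<leftarrow> Pi_pmf A undefined (p q); return_pmf (f, (g, q))}"
    by (subst bind_commute_pmf) simp
  also have "\<dots> = do {c \<leftarrow> do {q \<leftarrow> pQ; g \<leftarrow> Pi_pmf (D - A) undefined (p q); return_pmf (g, q)};
      f \<leftarrow> Pi_pmf A undefined (p (snd c)); return_pmf (f, c)}"
    by (simp add: bind_assoc_pmf bind_return_pmf)
  also have "do {q \<leftarrow> pQ; g \<leftarrow> Pi_pmf (D - A) undefined (p q); return_pmf (g, q)} = map_pmf (known A) joint"
    unfolding 1[symmetric] by (simp add: joint_def map_bind_pmf known_def bind_map_pmf)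
  finally show ?thesis .
qed

text \<open>Outside \<open>A\<close> the tuples agree, so the known codewords are those sent; on
  \<open>A\<close> the codewords are a fresh draw given \<open>q\<close>, independent of the output.
  This is exactly the law under which the density has mean at most 1.\<close>

lemma expectation_ratio_wrong_le_1:
  assumes m: "m \<in> messages M" "m' \<in> messages M" and A: "{k. m' k \<noteq> m k} = A" "A \<subseteq> D"
  shows "measure_pmf.expectation (letter M m m') (ratio A) \<le> 1"
proof -
  let ?R = "map_pmf (\<lambda>s. (out s, unknown A s, known A s)) (letter M m m')"
  have "measure_pmf.expectation ?R (info_ratio joint out (unknown A) (known A)) \<le> 1"
  proof (rule expectation_info_ratio_le_1[OF _ _ unknown_known_law[OF A(2)]])
    show "finite (set_pmf ?R)" by (simp add: finite_letter)
    have agree: "restrict (codewords c m') (D - A) = restrict (codewords c m) (D - A)" for c :: "'k \<times> nat \<Rightarrow> 'c"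
      using A by (auto simp: codewords_def fun_eq_iff)
    have "?R = do {q \<leftarrow> pQ; (f, x) \<leftarrow> map_pmf (\<lambda>c. (restrict (codewords c m') A, codewords c m)) (book M q);
        y \<leftarrow> v q x; return_pmf (y, f, (restrict x (D - A), q))}"
      by (simp add: letter_def letter_book_def map_bind_pmf bind_assoc_pmf bind_return_pmf bind_map_pmf
          out_def unknown_def known_def agree)
    also have "\<dots> = do {q \<leftarrow> pQ; f \<leftarrow> Pi_pmf A undefined (p q); x \<leftarrow> input q;
        y \<leftarrow> v q x; return_pmf (y, f, (restrict x (D - A), q))}"
      using codewords_pair_law[OF m] A(1) by (simp add: pair_pmf_def bind_assoc_pmf bind_return_pmf)
    \<comment> \<open>Neither \<open>x\<close> nor \<open>y\<close> depends on \<open>f\<close>, so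
      \<open>f\<close> may be drawn last, after the output and the known block.\<close>
    also have "\<dots> = do {q \<leftarrow> pQ; x \<leftarrow> input q; y \<leftarrow> v q x; f \<leftarrow> Pi_pmf A undefined (p q);
        return_pmf (y, f, (restrict x (D - A), q))}"
      by (subst bind_commute_pmf) (subst (2) bind_commute_pmf, simp)
    also have "\<dots> = do {(a, c) \<leftarrow> map_pmf (\<lambda>z. (out z, known A z)) joint;
        f \<leftarrow> Pi_pmf A undefined (p (snd c)); return_pmf (a, f, c)}"
      by (simp add: joint_def map_bind_pmf bind_assoc_pmf bind_return_pmf bind_map_pmf out_def known_def)
    finally show "?R = \<dots>" .
  qed
  then show ?thesis by (simp add: ratio_def[abs_def])
qed

lemma ratio_joint_pos: "s \<in> set_pmf joint \<Longrightarrow> 0 < ratio A s"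
  unfolding ratio_def by (rule info_ratio_pos)

lemma ratio_nonneg: "0 \<le> ratio A s"
  unfolding ratio_def by (rule info_ratio_nonneg)

text \<open>
  The codebook is generated letter by letter: \<open>C t\<close> holds the time-sharing letter and the \<open>t\<close>-th
  letters of all codewords. Everything observed is then i.i.d. in \<open>t\<close>.
\<close>

definition random_book :: "nat \<Rightarrow> ('k \<Rightarrow> nat) \<Rightarrow> (nat \<Rightarrow> 'q \<times> ('k \<times> nat \<Rightarrow> 'c)) pmf"
  where "random_book n M = Pi_pmf {..<n} undefined (\<lambda>_. letter_book M)"

definition received :: "nat \<Rightarrow> (nat \<Rightarrow> 'q \<times> ('k \<times> nat \<Rightarrow> 'c)) \<Rightarrow> ('k \<Rightarrow> nat) \<Rightarrow> (nat \<Rightarrow> 'y) pmf"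
  where "received n C m = Pi_pmf {..<n} undefined (\<lambda>t. v (fst (C t)) (codewords (snd (C t)) m))"

definition observed ::
  "(nat \<Rightarrow> 'q \<times> ('k \<times> nat \<Rightarrow> 'c)) \<Rightarrow> ('k \<Rightarrow> nat) \<Rightarrow> (nat \<Rightarrow> 'y) \<Rightarrow> nat \<Rightarrow> 'q \<times> ('k \<Rightarrow> 'c) \<times> 'y"
  where "observed C m y t = (fst (C t), codewords (snd (C t)) m, y t)"

text \<open>Drawing the whole codebook and then the whole output word amounts to drawing letters
  independently, since both stages are products over time. The restriction supplies the default
  value of \<open>Pi_pmf\<close> beyond \<open>n\<close>, where \<open>observed\<close> is still a
  triple.\<close>

lemma observed_law:
  "bind_pmf (random_book n M) (\<lambda>C. map_pmf (\<lambda>y. restrict (observed C m' y) {..<n}) (received n C m)) =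
    Pi_pmf {..<n} undefined (\<lambda>_. letter M m m')"
proof -
  have "Pi_pmf {..<n} undefined (\<lambda>_. letter M m m') =
     bind_pmf (random_book n M) (\<lambda>C. Pi_pmf {..<n} undefined (\<lambda>t. do {y \<leftarrow> v (fst (C t)) (codewords (snd (C t)) m);
       return_pmf (fst (C t), codewords (snd (C t)) m', y)}))"
    unfolding letter_def random_book_def case_prod_unfold by (intro Pi_pmf_bind) simp
  also have "\<dots> = bind_pmf (random_book n M) (\<lambda>C. map_pmf (\<lambda>y. restrict (observed C m' y) {..<n}) (received n C m))"
  proof (intro bind_pmf_cong refl)
    fix C
    show "Pi_pmf {..<n} undefined (\<lambda>t. do {y \<leftarrow> v (fst (C t)) (codewords (snd (C t)) m);
       return_pmf (fst (C t), codewords (snd (C t)) m', y)}) =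
       map_pmf (\<lambda>y. restrict (observed C m' y) {..<n}) (received n C m)"
      by (subst Pi_pmf_bind[where d' = undefined])
         (simp_all add: received_def map_pmf_def observed_def restrict_def cong: if_cong)
  qed
  finally show ?thesis ..
qed

lemma expected_observed:
  "measure_pmf.expectation (random_book n M)
     (\<lambda>C. measure_pmf.prob (received n C m) {y. P (restrict (observed C m' y) {..<n})}) =
   measure_pmf.prob (Pi_pmf {..<n} undefined (\<lambda>_. letter M m m')) {s. P s}"
  unfolding observed_law[symmetric] measure_bind_pmf by (simp add: vimage_def)

lemma prod_restrict_observed:
  "(\<Prod>t<n. ratio A (restrict (observed C m y) {..<n} t)) = (\<Prod>t<n. ratio A (observed C m y t))"
  by (intro prod.cong) auto

section \<open>The threshold decoder and its average error\<close>

definition test :: "nat \<Rightarrow> real \<Rightarrow> (nat \<Rightarrow> 'q \<times> ('k \<times> nat \<Rightarrow> 'c)) \<Rightarrow> (nat \<Rightarrow> 'y) \<Rightarrow> ('k \<Rightarrow> nat) \<Rightarrow> bool"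
  where "test n \<delta> C y m \<longleftrightarrow> (\<forall>A. A \<noteq> {} \<and> A \<subseteq> D \<longrightarrow>
    b powr (real n * (info A - \<delta>)) < (\<Prod>t<n. ratio A (observed C m y t)))"

text \<open>Uniqueness is asked only on \<open>D\<close>: tuples differing only in users treated as
  noise are not competitors.\<close>

definition decode ::
  "nat \<Rightarrow> real \<Rightarrow> ('k \<Rightarrow> nat) \<Rightarrow> (nat \<Rightarrow> 'q \<times> ('k \<times> nat \<Rightarrow> 'c)) \<Rightarrow> ('k \<Rightarrow> nat) \<Rightarrow> (nat \<Rightarrow> 'y) set"
  where "decode n \<delta> M C m = {y \<in> {..<n} \<rightarrow>\<^sub>E UNIV. test n \<delta> C y m \<and>
    (\<forall>m'\<in>messages M. test n \<delta> C y m' \<longrightarrow> (\<forall>k\<in>D. m' k = m k))}"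

lemma ratio_observed_cong:
  assumes "A \<subseteq> D" "\<And>k. k \<in> D \<Longrightarrow> m k = m' k"
  shows "ratio A (observed C m y t) = ratio A (observed C m' y t)"
proof -
  have "restrict (codewords c m) B = restrict (codewords c m') B" if "B \<subseteq> D" for B and c :: "'k \<times> nat \<Rightarrow> 'c"
    using that assms by (auto simp: codewords_def fun_eq_iff restrict_def)
  from this[of A] this[of "D - A"] show ?thesis
    using assms(1) by (simp add: ratio_def observed_def out_def unknown_def known_def)
qed

lemma test_cong:
  "(\<And>k. k \<in> D \<Longrightarrow> m k = m' k) \<Longrightarrow> test n \<delta> C y m \<longleftrightarrow> test n \<delta> C y m'"
  unfolding test_def using ratio_observed_cong[of _ m m' C y] by (simp cong: conj_cong)

lemma decode_cong:
  "(\<And>k. k \<in> D \<Longrightarrow> m k = m' k) \<Longrightarrow> decode n \<delta> M C m = decode n \<delta> M C m'"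
  unfolding decode_def using test_cong[of m m'] by auto

lemma decode_disjoint:
  assumes "m \<in> messages M" "k \<in> D" "m k \<noteq> m' k"
  shows "decode n \<delta> M C m \<inter> decode n \<delta> M C m' = {}"
  using assms unfolding decode_def by fastforce

text \<open>Either the sent tuple misses a threshold or a competitor passes. Of the competitor's
  thresholds only the one for its set of wrong components is kept, since its probability is the one
  under control.\<close>

lemma not_decodeD:
  assumes m: "m \<in> messages M" and y: "y \<in> {..<n} \<rightarrow>\<^sub>E UNIV" "y \<notin> decode n \<delta> M C m"
  obtains A where "A \<noteq> {}" "A \<subseteq> D" "(\<Prod>t<n. ratio A (observed C m y t)) \<le> b powr (real n * (info A - \<delta>))"
  | A m' where "A \<noteq> {}" "A \<subseteq> D" "m' \<in> messages M" "{k. m' k \<noteq> m k} = A"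
      "b powr (real n * (info A - \<delta>)) < (\<Prod>t<n. ratio A (observed C m' y t))"
proof (cases "test n \<delta> C y m")
  case False
  then show ?thesis using that(1) unfolding test_def by (auto simp: not_less)
next
  case True
  then obtain m0 k where m0: "m0 \<in> messages M" "test n \<delta> C y m0" "k \<in> D" "m0 k \<noteq> m k"
    using y unfolding decode_def by blast
  \<comment> \<open>The passing tuple may also differ from \<open>m\<close> outside
    \<open>D\<close>. Resetting those components confines the differences to \<open>D\<close> and
    leaves the test unchanged.\<close>
  define m' where "m' = (\<lambda>k. if k \<in> D then m0 k else m k)"
  have m': "m' \<in> messages M" using m m0 by (auto simp: m'_def messages_def)
  have t: "test n \<delta> C y m'" using m0(2) test_cong[of m' m0] by (simp add: m'_def)
  have k: "{k. m' k \<noteq> m k} \<noteq> {}"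
    using m0(3,4) unfolding m'_def by auto
  have sub: "{k. m' k \<noteq> m k} \<subseteq> D"
  proof
    fix j assume "j \<in> {k. m' k \<noteq> m k}"
    then show "j \<in> D" by (cases "j \<in> D") (simp_all add: m'_def)
  qed
  show ?thesis
    by (rule that(2)[OF k sub m' refl t[unfolded test_def, rule_format, OF conjI[OF k sub]]])
qed

text \<open>A union bound over \<open>A\<close> and over the tuples wrong exactly on
  \<open>A\<close>. The first summand is a threshold missed by the sent tuple, the second the number
  of competitors times the Markov bound.\<close>

lemma expected_error_le:
  assumes m: "m \<in> messages M"
  shows "measure_pmf.expectation (random_book n M)
      (\<lambda>C. measure_pmf.prob (received n C m) {y. y \<notin> decode n \<delta> M C m})
    \<le> (\<Sum>A\<in>{A. A \<noteq> {} \<and> A \<subseteq> D}.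
      measure_pmf.prob (Pi_pmf {..<n} undefined (\<lambda>_. joint))
        {s. (\<Prod>t<n. ratio A (s t)) \<le> b powr (real n * (info A - \<delta>))} +
      (\<Prod>k\<in>A. real (M k - 1)) * b powr (- (real n * (info A - \<delta>))))"
proof -
  let ?AA = "{A. A \<noteq> {} \<and> A \<subseteq> D}"
  let ?\<theta> = "\<lambda>A. b powr (real n * (info A - \<delta>))"
  let ?wrong = "\<lambda>A. {m' \<in> messages M. {k. m' k \<noteq> m k} = A}"
  let ?miss = "\<lambda>A s. (\<Prod>t<n. ratio A (s t)) \<le> ?\<theta> A"
  let ?hit = "\<lambda>A s. ?\<theta> A < (\<Prod>t<n. ratio A (s t))"
  let ?E = "measure_pmf.expectation (random_book n M)"
  let ?pr = "\<lambda>P m' C. measure_pmf.prob (received n C m) {y. P (restrict (observed C m' y) {..<n})}"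
  have fin: "finite ?AA" "finite (?wrong A)" for A by (simp_all add: finite_messages)
  have finC: "finite (set_pmf (random_book n M))"
    unfolding random_book_def by (intro finite_set_Pi_pmf finite_letter_book) auto
  note int = integrable_measure_pmf_finite[OF finC]
  \<comment> \<open>The union bound is taken for each fixed codebook; the estimates of its terms
    hold only after averaging over the codebook.\<close>
  have pointwise: "measure_pmf.prob (received n C m) {y. y \<notin> decode n \<delta> M C m} \<le>
      (\<Sum>A\<in>?AA. ?pr (?miss A) m C + (\<Sum>m'\<in>?wrong A. ?pr (?hit A) m' C))" for C
  proof -
    let ?U = "\<Union>A\<in>?AA. {y. ?miss A (restrict (observed C m y) {..<n})} \<union>
       (\<Union>m'\<in>?wrong A. {y. ?hit A (restrict (observed C m' y) {..<n})})"
    have "measure_pmf.prob (received n C m) {y. y \<notin> decode n \<delta> M C m} \<le> measure_pmf.prob (received n C m) ?U"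
    proof (rule measure_pmf.finite_measure_mono_AE, intro AE_pmfI impI)
      fix y assume "y \<in> set_pmf (received n C m)" and y: "y \<in> {y. y \<notin> decode n \<delta> M C m}"
      then have "y \<in> {..<n} \<rightarrow>\<^sub>E UNIV"
        unfolding received_def using set_Pi_pmf_subset[of "{..<n}" undefined] by (auto simp: PiE_def extensional_def)
      moreover have "y \<notin> decode n \<delta> M C m" using y by simp
      ultimately show "y \<in> ?U"
      proof (rule not_decodeD[OF m])
        fix A assume "A \<noteq> {}" "A \<subseteq> D" "(\<Prod>t<n. ratio A (observed C m y t)) \<le> ?\<theta> A"
        then show "y \<in> ?U" by (intro UN_I[of A] UnI1) (simp_all only: prod_restrict_observed mem_Collect_eq simp_thms)
      next
        fix A m' assume "A \<noteq> {}" "A \<subseteq> D" "m' \<in> messages M" "{k. m' k \<noteq> m k} = A"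
          "?\<theta> A < (\<Prod>t<n. ratio A (observed C m' y t))"
        then show "y \<in> ?U" by (intro UN_I[of A] UnI2 UN_I[of m']) (simp_all only: prod_restrict_observed mem_Collect_eq simp_thms)
      qed
    qed auto
    also have "\<dots> \<le> (\<Sum>A\<in>?AA. measure_pmf.prob (received n C m)
       ({y. ?miss A (restrict (observed C m y) {..<n})} \<union>
       (\<Union>m'\<in>?wrong A. {y. ?hit A (restrict (observed C m' y) {..<n})})))"
      using fin by (intro measure_UNION_le) auto
    also have "\<dots> \<le> (\<Sum>A\<in>?AA. ?pr (?miss A) m C + (\<Sum>m'\<in>?wrong A. ?pr (?hit A) m' C))"
    proof (intro sum_mono)
      fix A
      show "measure_pmf.prob (received n C m)
       ({y. ?miss A (restrict (observed C m y) {..<n})} \<union>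
       (\<Union>m'\<in>?wrong A. {y. ?hit A (restrict (observed C m' y) {..<n})}))
       \<le> ?pr (?miss A) m C + (\<Sum>m'\<in>?wrong A. ?pr (?hit A) m' C)"
        by (rule order_trans[OF measure_Un_le]) (auto intro!: measure_UNION_le fin)
    qed
    finally show ?thesis .
  qed
  have "?E (\<lambda>C. measure_pmf.prob (received n C m) {y. y \<notin> decode n \<delta> M C m}) \<le>
      ?E (\<lambda>C. \<Sum>A\<in>?AA. ?pr (?miss A) m C + (\<Sum>m'\<in>?wrong A. ?pr (?hit A) m' C))"
    by (intro integral_mono int pointwise)
  also have "\<dots> = (\<Sum>A\<in>?AA. ?E (?pr (?miss A) m) + (\<Sum>m'\<in>?wrong A. ?E (?pr (?hit A) m')))"
    by (simp only: Bochner_Integration.integral_sum[OF int] Bochner_Integration.integral_add[OF int int])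
  also have "\<dots> \<le> (\<Sum>A\<in>?AA. measure_pmf.prob (Pi_pmf {..<n} undefined (\<lambda>_. joint)) {s. ?miss A s} +
      (\<Prod>k\<in>A. real (M k - 1)) * b powr (- (real n * (info A - \<delta>))))"
  proof (intro sum_mono add_mono)
    fix A assume A: "A \<in> ?AA"
    show "?E (?pr (?miss A) m) \<le> measure_pmf.prob (Pi_pmf {..<n} undefined (\<lambda>_. joint)) {s. ?miss A s}"
      by (simp only: expected_observed[of n M m "?miss A" m] letter_same[OF m])
    have "?E (?pr (?hit A) m') \<le> b powr (- (real n * (info A - \<delta>)))" if m': "m' \<in> ?wrong A" for m'
    proof -
      have "measure_pmf.prob (Pi_pmf {..<n} undefined (\<lambda>_. letter M m m')) {s. ?hit A s} \<le> 1 / ?\<theta> A"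
      proof (rule iid_ratio_tail[OF finite_letter ratio_nonneg])
        show "measure_pmf.expectation (letter M m m') (ratio A) \<le> 1"
          by (rule expectation_ratio_wrong_le_1[OF m]) (use m' A in auto)
      qed (use b in auto)
      then show ?thesis
        by (simp only: expected_observed[of n M m "?hit A" m']) (simp add: powr_minus_divide)
    qed
    then have "(\<Sum>m'\<in>?wrong A. ?E (?pr (?hit A) m')) \<le> real (card (?wrong A)) * b powr (- (real n * (info A - \<delta>)))"
      by (intro sum_bounded_above) auto
    then show "(\<Sum>m'\<in>?wrong A. ?E (?pr (?hit A) m')) \<le> (\<Prod>k\<in>A. real (M k - 1)) * b powr (- (real n * (info A - \<delta>)))"
      by (simp only: card_messages_differing[OF m] of_nat_prod)
  qed
  finally show ?thesis .
qed

section \<open>Code sizes and vanishing error\<close>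

definition sizes :: "('k \<Rightarrow> real) \<Rightarrow> real \<Rightarrow> nat \<Rightarrow> 'k \<Rightarrow> nat"
  where "sizes rate \<eta> n k = nat \<lceil>b powr (real n * (rate k - \<eta>))\<rceil>"

lemma sizes_ge: "b powr (real n * (rate k - \<eta>)) \<le> real (sizes rate \<eta> n k)"
  unfolding sizes_def by linarith

lemma sizes_pos: "1 \<le> sizes rate \<eta> n k"
proof -
  have "0 < real (sizes rate \<eta> n k)"
    using b by (intro less_le_trans[OF _ sizes_ge]) simp
  then show ?thesis by linarith
qed

text \<open>The ceiling exceeds its argument by less than 1, so the number of wrong indices obeys
  the bound without rounding loss, even at negative exponents, where the size is 1.\<close>

lemma sizes_minus_one_le: "real (sizes rate \<eta> n k - 1) \<le> b powr (real n * (rate k - \<eta>))"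
proof -
  have "0 \<le> b powr (real n * (rate k - \<eta>))" by simp
  then show ?thesis unfolding sizes_def by linarith
qed

text \<open>Rates are lowered by \<eta> per user, thresholds only by \<eta>/2. As \<open>A\<close>
  is nonempty, its wrong tuples contribute at most \<open>b powr (- \<eta> / 2) ^ n\<close>. The
  bound \<open>e\<close> is uniform in \<open>m\<close>, so averages over messages inherit
  it.\<close>

lemma random_coding:
  assumes rates: "\<And>A. A \<noteq> {} \<Longrightarrow> A \<subseteq> D \<Longrightarrow> (\<Sum>k\<in>A. rate k) \<le> info A"
    and \<eta>: "0 < \<eta>"
  obtains e where "e \<longlonglongrightarrow> 0"
    "\<And>n m. m \<in> messages (sizes rate \<eta> n) \<Longrightarrow>
      measure_pmf.expectation (random_book n (sizes rate \<eta> n))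
       (\<lambda>C. measure_pmf.prob (received n C m) {y. y \<notin> decode n (\<eta> / 2) (sizes rate \<eta> n) C m}) \<le> e n"
proof
  let ?AA = "{A. A \<noteq> {} \<and> A \<subseteq> D}"
  let ?miss = "\<lambda>A n. measure_pmf.prob (Pi_pmf {..<n} undefined (\<lambda>_. joint))
        {s. (\<Prod>t<n. ratio A (s t)) \<le> b powr (real n * (info A - \<eta> / 2))}"
  have lim1: "?miss A \<longlonglongrightarrow> 0" for A
    unfolding info_altdef
    by (rule iid_ratio_lower_tail[OF finite_joint _ b]) (use \<eta> in \<open>auto intro: ratio_joint_pos\<close>)
  have "b powr (- \<eta> / 2) < 1"
    using b \<eta> by (simp add: powr_less_one)
  then have lim2: "(\<lambda>n. (b powr (- \<eta> / 2)) ^ n) \<longlonglongrightarrow> 0"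
    by (intro LIMSEQ_power_zero) simp
  show "(\<lambda>n. \<Sum>A\<in>?AA. ?miss A n + (b powr (- \<eta> / 2)) ^ n) \<longlonglongrightarrow> 0"
    by (rule tendsto_null_sum) (use tendsto_add[OF lim1 lim2] in simp)
  fix n m assume m: "m \<in> messages (sizes rate \<eta> n)"
  have "measure_pmf.expectation (random_book n (sizes rate \<eta> n))
       (\<lambda>C. measure_pmf.prob (received n C m) {y. y \<notin> decode n (\<eta> / 2) (sizes rate \<eta> n) C m}) \<le>
     (\<Sum>A\<in>?AA. ?miss A n + (\<Prod>k\<in>A. real (sizes rate \<eta> n k - 1)) * b powr (- (real n * (info A - \<eta> / 2))))"
    by (rule expected_error_le[OF m])
  also have "\<dots> \<le> (\<Sum>A\<in>?AA. ?miss A n + (b powr (- \<eta> / 2)) ^ n)"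
  proof (intro sum_mono add_left_mono)
    fix A assume A: "A \<in> ?AA"
    have "1 \<le> card A" using A by (simp add: Suc_le_eq card_gt_0_iff)
    then have "\<eta> \<le> real (card A) * \<eta>" using \<eta> by simp
    have "(\<Prod>k\<in>A. real (sizes rate \<eta> n k - 1)) \<le> (\<Prod>k\<in>A. b powr (real n * (rate k - \<eta>)))"
      by (intro prod_mono conjI sizes_minus_one_le) simp
    also have "\<dots> = b powr (\<Sum>k\<in>A. real n * (rate k - \<eta>))"
      using b by (simp add: powr_sum)
    also have "(\<Sum>k\<in>A. real n * (rate k - \<eta>)) = real n * ((\<Sum>k\<in>A. rate k) - real (card A) * \<eta>)"
      by (simp add: sum_distrib_left[symmetric] sum_subtractf)
    finally have "(\<Prod>k\<in>A. real (sizes rate \<eta> n k - 1)) * b powr (- (real n * (info A - \<eta> / 2))) \<le>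
       b powr (real n * ((\<Sum>k\<in>A. rate k) - real (card A) * \<eta>)) * b powr (- (real n * (info A - \<eta> / 2)))"
      by (intro mult_right_mono) auto
    also have "\<dots> = b powr (real n * ((\<Sum>k\<in>A. rate k) - real (card A) * \<eta> - (info A - \<eta> / 2)))"
      by (simp add: powr_add[symmetric] algebra_simps)
    also have "\<dots> \<le> b powr (real n * (- \<eta> / 2))"
      using b A rates[of A] \<open>\<eta> \<le> real (card A) * \<eta>\<close> by (intro powr_mono mult_left_mono) auto
    also have "\<dots> = (b powr (- \<eta> / 2)) ^ n"
      by (subst powr_power) (use b in auto)
    finally show "(\<Prod>k\<in>A. real (sizes rate \<eta> n k - 1)) * b powr (- (real n * (info A - \<eta> / 2))) \<le> (b powr (- \<eta> / 2)) ^ n" .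
  qed
  finally show "measure_pmf.expectation (random_book n (sizes rate \<eta> n))
       (\<lambda>C. measure_pmf.prob (received n C m) {y. y \<notin> decode n (\<eta> / 2) (sizes rate \<eta> n) C m}) \<le>
     (\<Sum>A\<in>?AA. ?miss A n + (b powr (- \<eta> / 2)) ^ n)" .
qed

end

section \<open>The rate-splitting channel\<close>

text \<open>The secondary encoder becomes two virtual users: \<open>UU\<close> carries the index
  \<open>k\<close> of rate \<open>S\<close>, \<open>UW\<close> the index \<open>l\<close> of rate
  \<open>T\<close>.\<close>

datatype user = UX1 | UX2 | UU | UW

lemma UNIV_user: "UNIV = {UX1, UX2, UU, UW}"
  using user.exhaust by auto

instance user :: finite
  by standard (simp add: UNIV_user)

text \<open>Coding into natural numbers gives the four users a common alphabet, as a product law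
  over users requires.\<close>

definition letters :: "('x1::finite, 'x2::finite, 'xs, 'yp, 'ys) outcome \<Rightarrow> user \<Rightarrow> nat"
  where "letters z = case_user (to_nat (rvX1 z)) (to_nat (rvX2 z)) (rvU z) (rvW z)"

definition letter_law ::
  "('x1::finite, 'x2::finite, 'xs, 'yp, 'ys) outcome pmf \<Rightarrow> nat \<Rightarrow> user \<Rightarrow> nat pmf"
  where "letter_law Z q u = map_pmf (\<lambda>z. letters z u) (cond_pmf Z {z. rvQ z = q})"

text \<open>Absorbing \<open>f\<close> into the channel leaves four users whose inputs are
  independent given the time-sharing letter.\<close>

definition letter_channel ::
  "('x1::finite \<Rightarrow> 'x2::finite \<Rightarrow> 'xs \<Rightarrow> 'y pmf) \<Rightarrow> (nat \<Rightarrow> nat \<Rightarrow> nat \<Rightarrow> 'xs) \<Rightarrow>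
   nat \<Rightarrow> (user \<Rightarrow> nat) \<Rightarrow> 'y pmf"
  where "letter_channel V f q x = V (from_nat (x UX1)) (from_nat (x UX2)) (f (x UU) (x UW) q)"

lemma letters_simps [simp]:
  "letters z UX1 = to_nat (rvX1 z)" "letters z UX2 = to_nat (rvX2 z)"
  "letters z UU = rvU z" "letters z UW = rvW z"
  by (simp_all add: letters_def)

lemma bind_cond_pmf_fibre: "bind_pmf (map_pmf h Z) (\<lambda>a. cond_pmf Z {z. h z = a}) = Z"
proof -
  have "bind_pmf Z (\<lambda>z. cond_pmf Z {z'. h z' = h z}) = Z"
    by (rule bind_cond_pmf_cancel[where R = "\<lambda>z z'. h z' = h z"]) (auto simp: eq_commute)
  then show ?thesis by (simp add: bind_map_pmf)
qed

text \<open>Iterated form of the product law, to be matched with the nested \<open>pair_pmf\<close>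
  in \<open>P_star\<close>.\<close>

lemma Pi_pmf_user:
  "Pi_pmf UNIV undefined P = do {x1 \<leftarrow> P UX1; x2 \<leftarrow> P UX2; u \<leftarrow> P UU; w \<leftarrow> P UW;
     return_pmf (case_user x1 x2 u w)}"
proof -
  have "((\<lambda>_. undefined)(UW := w, UU := u, UX2 := x2, UX1 := x1)) = case_user x1 x2 u w"
    for x1 x2 u w :: 'a
    by (auto simp: fun_eq_iff split: user.split)
  then show ?thesis
    by (simp add: UNIV_user Pi_pmf_insert' bind_assoc_pmf bind_return_pmf)
qed

lemma letters_law:
  assumes Z: "Z \<in> P_star \<omega>" and q: "q \<in> rvQ ` set_pmf Z"
  shows "map_pmf letters (cond_pmf Z {z. rvQ z = q}) = Pi_pmf UNIV undefined (letter_law Z q)"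
proof -
  let ?Zq = "cond_pmf Z {z. rvQ z = q}"
  let ?enc = "\<lambda>(a, b, u, w). case_user (to_nat a) (to_nat b) u w"
  have indep: "map_pmf (\<lambda>z. (rvX1 z, rvX2 z, rvU z, rvW z)) ?Zq =
        pair_pmf (map_pmf rvX1 ?Zq) (pair_pmf (map_pmf rvX2 ?Zq)
          (pair_pmf (map_pmf rvU ?Zq) (map_pmf rvW ?Zq)))"
    using Z q unfolding P_star_def Let_def by blast
  have "map_pmf letters ?Zq = map_pmf ?enc (map_pmf (\<lambda>z. (rvX1 z, rvX2 z, rvU z, rvW z)) ?Zq)"
    by (simp add: pmf.map_comp o_def letters_def[abs_def])
  also have "\<dots> = Pi_pmf UNIV undefined (letter_law Z q)"
    unfolding indep Pi_pmf_user
    by (simp add: letter_law_def pair_pmf_def map_bind_pmf bind_map_pmf bind_return_pmf bind_assoc_pmf)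
  finally show ?thesis .
qed

text \<open>Chain rule along time-sharing letter, inputs and output. The projection \<open>h\<close>
  selects a receiver, so one statement serves both.\<close>

lemma letters_joint_law:
  fixes Z :: "('x1::finite, 'x2::finite, 'xs, 'yp, 'ys) outcome pmf"
  assumes Z: "Z \<in> P_star \<omega>" and f: "\<And>z. z \<in> set_pmf Z \<Longrightarrow> rvXs z = f (rvU z) (rvW z) (rvQ z)"
  shows "map_pmf (\<lambda>z. (rvQ z, letters z, h (rvYp z, rvYs z))) Z =
    do {q \<leftarrow> map_pmf rvQ Z; x \<leftarrow> Pi_pmf UNIV undefined (letter_law Z q);
        y \<leftarrow> letter_channel (\<lambda>x1 x2 xs. map_pmf h (\<omega> x1 x2 xs)) f q x; return_pmf (q, x, y)}"
proof -
  let ?V = "letter_channel (\<lambda>x1 x2 xs. map_pmf h (\<omega> x1 x2 xs)) f"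
  let ?H = "\<lambda>z. (rvQ z, letters z, h (rvYp z, rvYs z))"
  let ?I = "\<lambda>z. (rvQ z, rvU z, rvW z, rvX1 z, rvX2 z, rvXs z)"
  have QX: "map_pmf (\<lambda>z. (rvQ z, letters z)) Z =
      do {q \<leftarrow> map_pmf rvQ Z; x \<leftarrow> Pi_pmf UNIV undefined (letter_law Z q); return_pmf (q, x)}"
  proof -
    have "map_pmf (\<lambda>z. (rvQ z, letters z)) Z =
      map_pmf (\<lambda>z. (rvQ z, letters z)) (bind_pmf (map_pmf rvQ Z) (\<lambda>q. cond_pmf Z {z. rvQ z = q}))"
      by (simp only: bind_cond_pmf_fibre)
    also have "\<dots> = bind_pmf (map_pmf rvQ Z) (\<lambda>q. map_pmf (Pair q) (map_pmf letters (cond_pmf Z {z. rvQ z = q})))"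
      unfolding map_bind_pmf
    proof (intro bind_pmf_cong refl)
      fix q assume "q \<in> set_pmf (map_pmf rvQ Z)"
      then have "set_pmf Z \<inter> {z. rvQ z = q} \<noteq> {}" by auto
      then show "map_pmf (\<lambda>z. (rvQ z, letters z)) (cond_pmf Z {z. rvQ z = q}) =
          map_pmf (Pair q) (map_pmf letters (cond_pmf Z {z. rvQ z = q}))"
        unfolding pmf.map_comp by (intro map_pmf_cong refl) (auto simp: set_cond_pmf)
    qed
    also have "\<dots> = do {q \<leftarrow> map_pmf rvQ Z; x \<leftarrow> Pi_pmf UNIV undefined (letter_law Z q); return_pmf (q, x)}"
      by (intro bind_pmf_cong refl) (simp add: letters_law[OF Z] map_pmf_def[symmetric])
    finally show ?thesis .
  qed
  \<comment> \<open>Disintegrating over all inputs, \<open>rvXs\<close> included, produces the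
    conditioning events for which \<open>P_star\<close> prescribes the channel law.\<close>
  have "map_pmf ?H Z = map_pmf ?H (bind_pmf (map_pmf ?I Z) (\<lambda>a. cond_pmf Z {z. ?I z = a}))"
    by (simp only: bind_cond_pmf_fibre)
  also have "\<dots> = bind_pmf Z (\<lambda>z. map_pmf (\<lambda>y. (rvQ z, letters z, y)) (?V (rvQ z) (letters z)))"
    unfolding map_bind_pmf bind_map_pmf
  proof (intro bind_pmf_cong refl)
    fix z assume z: "z \<in> set_pmf Z"
    let ?C = "cond_pmf Z {z'. ?I z' = ?I z}"
    have "set_pmf Z \<inter> {z'. ?I z' = ?I z} \<noteq> {}" using z by auto
    then have same: "?I z' = ?I z" if "z' \<in> set_pmf ?C" for z'
      using that unfolding set_cond_pmf[OF \<open>set_pmf Z \<inter> {z'. ?I z' = ?I z} \<noteq> {}\<close>] by blast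
    have "map_pmf ?H ?C = map_pmf (\<lambda>(yp, ys). (rvQ z, letters z, h (yp, ys))) (map_pmf (\<lambda>z'. (rvYp z', rvYs z')) ?C)"
      unfolding pmf.map_comp
    proof (rule map_pmf_cong[OF refl])
      fix z' assume "z' \<in> set_pmf ?C"
      from same[OF this] show "?H z' = ((\<lambda>(yp, ys). (rvQ z, letters z, h (yp, ys))) \<circ> (\<lambda>z'. (rvYp z', rvYs z'))) z'"
        by (simp add: letters_def)
    qed
    also have "map_pmf (\<lambda>z'. (rvYp z', rvYs z')) ?C = \<omega> (rvX1 z) (rvX2 z) (rvXs z)"
      using Z z unfolding P_star_def by simp
    also have "map_pmf (\<lambda>(yp, ys). (rvQ z, letters z, h (yp, ys))) (\<omega> (rvX1 z) (rvX2 z) (rvXs z)) =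
       map_pmf (\<lambda>y. (rvQ z, letters z, y)) (?V (rvQ z) (letters z))"
      by (simp add: letter_channel_def pmf.map_comp o_def f[OF z, symmetric] case_prod_unfold)
    finally show "map_pmf ?H ?C = \<dots>" .
  qed
  also have "\<dots> = bind_pmf (map_pmf (\<lambda>z. (rvQ z, letters z)) Z) (\<lambda>(q, x). do {y \<leftarrow> ?V q x; return_pmf (q, x, y)})"
    by (simp add: bind_map_pmf map_pmf_def[symmetric])
  also have "\<dots> = do {q \<leftarrow> map_pmf rvQ Z; x \<leftarrow> Pi_pmf UNIV undefined (letter_law Z q);
        y \<leftarrow> ?V q x; return_pmf (q, x, y)}"
    unfolding QX by (simp add: bind_assoc_pmf bind_return_pmf)
  finally show ?thesis .
qed

lemma restrict_eq_iff: "restrict x A = restrict y A \<longleftrightarrow> (\<forall>k\<in>A. x k = y k)"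
  by (auto simp: fun_eq_iff restrict_def)

section \<open>Averages and closedness of achievability\<close>

lemma average_le:
  fixes g :: "nat \<Rightarrow> nat \<Rightarrow> nat \<Rightarrow> nat \<Rightarrow> real"
  assumes M: "1 \<le> M1" "1 \<le> M2" "1 \<le> L" "1 \<le> N"
    and g: "\<And>i j k l. i \<in> {1..M1} \<Longrightarrow> j \<in> {1..M2} \<Longrightarrow> k \<in> {1..L} \<Longrightarrow> l \<in> {1..N} \<Longrightarrow> g i j k l \<le> e"
  shows "1 / (real M1 * real M2 * real L * real N) *
    (\<Sum>i=1..M1. \<Sum>j=1..M2. \<Sum>k=1..L. \<Sum>l=1..N. g i j k l) \<le> e"
proof -
  have "(\<Sum>i=1..M1. \<Sum>j=1..M2. \<Sum>k=1..L. \<Sum>l=1..N. g i j k l) \<le>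
      (\<Sum>i=1..M1. \<Sum>j=1..M2. \<Sum>k=1..L. \<Sum>l=1..N. e)"
    by (intro sum_mono g)
  also have "\<dots> = real M1 * real M2 * real L * real N * e" by simp
  finally have "(\<Sum>i=1..M1. \<Sum>j=1..M2. \<Sum>k=1..L. \<Sum>l=1..N. g i j k l) / (real M1 * real M2 * real L * real N) \<le> e"
    using M by (subst pos_divide_le_eq) (simp_all add: mult.commute)
  then show ?thesis by simp
qed

lemma exists_le_expectation:
  fixes g :: "'a \<Rightarrow> real"
  assumes fin: "finite (set_pmf P)" and le: "measure_pmf.expectation P g \<le> e"
  shows "\<exists>x\<in>set_pmf P. g x \<le> e"
proof (rule ccontr)
  assume "\<not> ?thesis"
  then have gt: "e < g x" if "x \<in> set_pmf P" for x using that by force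
  have "e = (\<Sum>x\<in>set_pmf P. e * pmf P x)"
    using fin by (simp add: sum_distrib_left[symmetric] sum_pmf_eq_1)
  also have "\<dots> < (\<Sum>x\<in>set_pmf P. g x * pmf P x)"
    using fin gt by (intro sum_strict_mono) (auto simp: set_pmf_not_empty pmf_positive)
  also have "\<dots> = measure_pmf.expectation P g"
    using fin by (intro integral_measure_pmf_real[symmetric]) auto
  finally show False using le by simp
qed

text \<open>Half of the slack \<eta> pays for replacing the limit by one member of the sequence, the
  other half goes to the codes of that member.\<close>

lemma achievable_closed:
  assumes ach: "\<And>n. achievable b \<omega> (R1 n) (R2 n) (S n) (T n)"
    and lim: "R1 \<longlonglongrightarrow> r1" "R2 \<longlonglongrightarrow> r2" "S \<longlonglongrightarrow> s" "T \<longlonglongrightarrow> t"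
  shows "achievable b \<omega> r1 r2 s t"
  unfolding achievable_def
proof (intro conjI allI impI)
  have nn: "0 \<le> R1 n" "0 \<le> R2 n" "0 \<le> S n" "0 \<le> T n" for n
    using ach[of n] unfolding achievable_def by blast+
  show "0 \<le> r1" "0 \<le> r2" "0 \<le> s" "0 \<le> t"
    using lim nn by (auto intro: LIMSEQ_le_const)
  fix \<eta> \<epsilon> :: real assume \<eta>: "0 < \<eta>" and \<epsilon>: "0 < \<epsilon> \<and> \<epsilon> < 1"
  have "\<forall>\<^sub>F n in sequentially. r1 - \<eta> / 2 < R1 n \<and> r2 - \<eta> / 2 < R2 n \<and> s - \<eta> / 2 < S n \<and> t - \<eta> / 2 < T n"
    using \<eta> lim by (intro eventually_conj order_tendstoD) auto
  then obtain N where N: "r1 - \<eta> / 2 < R1 N" "r2 - \<eta> / 2 < R2 N" "s - \<eta> / 2 < S N" "t - \<eta> / 2 < T N"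
    using eventually_happens'[OF sequentially_bot] by blast
  have "0 < \<eta> / 2" using \<eta> by simp
  then have "\<forall>\<^sub>F n in sequentially. \<exists>M1 M2 Ls Ns x1 x2 xs Dp Ds.
           is_code \<omega> n M1 M2 Ls Ns \<epsilon> x1 x2 xs Dp Ds \<and>
           1 / real n * log b (real M1) \<ge> R1 N - \<eta> / 2 \<and>
           1 / real n * log b (real M2) \<ge> R2 N - \<eta> / 2 \<and>
           1 / real n * log b (real Ls) \<ge> S N - \<eta> / 2 \<and>
           1 / real n * log b (real Ns) \<ge> T N - \<eta> / 2"
    using ach[of N] \<epsilon> unfolding achievable_def by blast
  then show "\<forall>\<^sub>F n in sequentially. \<exists>M1 M2 Ls Ns x1 x2 xs Dp Ds.
           is_code \<omega> n M1 M2 Ls Ns \<epsilon> x1 x2 xs Dp Ds \<and>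
           1 / real n * log b (real M1) \<ge> r1 - \<eta> \<and>
           1 / real n * log b (real M2) \<ge> r2 - \<eta> \<and>
           1 / real n * log b (real Ls) \<ge> s - \<eta> \<and>
           1 / real n * log b (real Ns) \<ge> t - \<eta>"
  proof (rule eventually_mono, elim exE conjE)
    fix n M1 M2 Ls Ns x1 x2 xs Dp Ds
    assume "is_code \<omega> n M1 M2 Ls Ns \<epsilon> x1 x2 xs Dp Ds"
      and "1 / real n * log b (real M1) \<ge> R1 N - \<eta> / 2" "1 / real n * log b (real M2) \<ge> R2 N - \<eta> / 2"
        "1 / real n * log b (real Ls) \<ge> S N - \<eta> / 2" "1 / real n * log b (real Ns) \<ge> T N - \<eta> / 2"
    then show "\<exists>M1 M2 Ls Ns x1 x2 xs Dp Ds.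
           is_code \<omega> n M1 M2 Ls Ns \<epsilon> x1 x2 xs Dp Ds \<and>
           1 / real n * log b (real M1) \<ge> r1 - \<eta> \<and>
           1 / real n * log b (real M2) \<ge> r2 - \<eta> \<and>
           1 / real n * log b (real Ls) \<ge> s - \<eta> \<and>
           1 / real n * log b (real Ns) \<ge> t - \<eta>"
      using N by (intro exI[of _ M1] exI[of _ M2] exI[of _ Ls] exI[of _ Ns] exI[of _ x1] exI[of _ x2]
        exI[of _ xs] exI[of _ Dp] exI[of _ Ds] conjI) linarith+
  qed
qed

section \<open>Codes for a fixed tuple of random variables\<close>

lemma marg_conv: "marg_p \<omega> = (\<lambda>x1 x2 xs. map_pmf fst (\<omega> x1 x2 xs))"
  "marg_s \<omega> = (\<lambda>x1 x2 xs. map_pmf snd (\<omega> x1 x2 xs))"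
  by (simp_all add: fun_eq_iff marg_p_def marg_s_def)

text \<open>Both receivers see multiple access channels with the same four inputs. The primary one
  decodes \<open>UX1\<close>, \<open>UX2\<close>, \<open>UW\<close> with \<open>UU\<close> as noise,
  the secondary one \<open>UU\<close>, \<open>UW\<close> with \<open>UX1\<close>, \<open>UX2\<close>
  as noise.\<close>

lemma achievable_of_P_star:
  fixes \<omega> :: "'x1::finite \<Rightarrow> 'x2::finite \<Rightarrow> 'xs::finite \<Rightarrow> ('yp::finite \<times> 'ys::finite) pmf"
  assumes b: "1 < b" and Z: "Z \<in> P_star \<omega>"
    and nonneg: "0 \<le> R1" "0 \<le> R2" "0 \<le> S" "0 \<le> T"
    and rates_p: "R1 \<le> cond_info b Z rvYp rvX1 (\<lambda>z. (rvW z, rvX2 z, rvQ z))"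
     "R2 \<le> cond_info b Z rvYp rvX2 (\<lambda>z. (rvW z, rvX1 z, rvQ z))"
     "T \<le> cond_info b Z rvYp rvW (\<lambda>z. (rvX1 z, rvX2 z, rvQ z))"
     "R1 + R2 \<le> cond_info b Z rvYp (\<lambda>z. (rvX1 z, rvX2 z)) (\<lambda>z. (rvW z, rvQ z))"
     "T + R1 \<le> cond_info b Z rvYp (\<lambda>z. (rvW z, rvX1 z)) (\<lambda>z. (rvX2 z, rvQ z))"
     "T + R2 \<le> cond_info b Z rvYp (\<lambda>z. (rvW z, rvX2 z)) (\<lambda>z. (rvX1 z, rvQ z))"
     "T + R1 + R2 \<le> cond_info b Z rvYp (\<lambda>z. (rvW z, rvX1 z, rvX2 z)) rvQ"
    and rates_s: "S \<le> cond_info b Z rvYs rvU (\<lambda>z. (rvW z, rvQ z))"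
     "T \<le> cond_info b Z rvYs rvW (\<lambda>z. (rvU z, rvQ z))"
     "S + T \<le> cond_info b Z rvYs (\<lambda>z. (rvU z, rvW z)) rvQ"
  shows "achievable b \<omega> R1 R2 S T"
proof -
  have finZ: "finite (set_pmf Z)" using Z unfolding P_star_def by blast
  obtain f where f: "\<And>z. z \<in> set_pmf Z \<Longrightarrow> rvXs z = f (rvU z) (rvW z) (rvQ z)"
    using Z unfolding P_star_def by blast
  define Vp where "Vp = letter_channel (marg_p \<omega>) f"
  define Vs where "Vs = letter_channel (marg_s \<omega>) f"
  have fin_law: "finite (set_pmf (letter_law Z q u))" if "q \<in> set_pmf (map_pmf rvQ Z)" for q u
  proof -
    have "set_pmf Z \<inter> {z. rvQ z = q} \<noteq> {}" using that by auto
    then show ?thesis using finZ by (simp add: letter_law_def set_cond_pmf)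
  qed
  interpret P: multiple_access b "map_pmf rvQ Z" "letter_law Z" Vp "{UX1, UX2, UW}"
    by unfold_locales (use b finZ fin_law in auto)
  interpret S: multiple_access b "map_pmf rvQ Z" "letter_law Z" Vs "{UU, UW}"
    by unfold_locales (use b finZ fin_law in auto)
  have P_joint: "P.joint = map_pmf (\<lambda>z. (rvQ z, letters z, rvYp z)) Z"
    using letters_joint_law[OF Z f, of fst]
    unfolding P.joint_def P.input_def by (simp add: Vp_def marg_conv)
  have S_joint: "S.joint = map_pmf (\<lambda>z. (rvQ z, letters z, rvYs z)) Z"
    using letters_joint_law[OF Z f, of snd]
    unfolding S.joint_def S.input_def by (simp add: Vs_def marg_conv)
  define rate where "rate = case_user R1 R2 S T"
  note P_info = P.info_def P_joint cond_info_eq_cinfo[OF b finZ]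
  note S_info = S.info_def S_joint cond_info_eq_cinfo[OF b finZ]
  note P_simps = P.out_def P.unknown_def P.known_def restrict_eq_iff insert_Diff_if
  note S_simps = S.out_def S.unknown_def S.known_def restrict_eq_iff insert_Diff_if
  have P1: "P.info {UX1} = cond_info b Z rvYp rvX1 (\<lambda>z. (rvW z, rvX2 z, rvQ z))"
    unfolding P_info by (rule cinfo_relabel) (auto simp: P_simps)
  have P2: "P.info {UX2} = cond_info b Z rvYp rvX2 (\<lambda>z. (rvW z, rvX1 z, rvQ z))"
    unfolding P_info by (rule cinfo_relabel) (auto simp: P_simps)
  have P3: "P.info {UW} = cond_info b Z rvYp rvW (\<lambda>z. (rvX1 z, rvX2 z, rvQ z))"
    unfolding P_info by (rule cinfo_relabel) (auto simp: P_simps)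
  have P12: "P.info {UX1, UX2} = cond_info b Z rvYp (\<lambda>z. (rvX1 z, rvX2 z)) (\<lambda>z. (rvW z, rvQ z))"
    unfolding P_info by (rule cinfo_relabel) (auto simp: P_simps)
  have P13: "P.info {UX1, UW} = cond_info b Z rvYp (\<lambda>z. (rvW z, rvX1 z)) (\<lambda>z. (rvX2 z, rvQ z))"
    unfolding P_info by (rule cinfo_relabel) (auto simp: P_simps)
  have P23: "P.info {UX2, UW} = cond_info b Z rvYp (\<lambda>z. (rvW z, rvX2 z)) (\<lambda>z. (rvX1 z, rvQ z))"
    unfolding P_info by (rule cinfo_relabel) (auto simp: P_simps)
  have P123: "P.info {UX1, UX2, UW} = cond_info b Z rvYp (\<lambda>z. (rvW z, rvX1 z, rvX2 z)) rvQ"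
    unfolding P_info by (rule cinfo_relabel) (auto simp: P_simps)
  have S1: "S.info {UU} = cond_info b Z rvYs rvU (\<lambda>z. (rvW z, rvQ z))"
    unfolding S_info by (rule cinfo_relabel) (auto simp: S_simps)
  have S2: "S.info {UW} = cond_info b Z rvYs rvW (\<lambda>z. (rvU z, rvQ z))"
    unfolding S_info by (rule cinfo_relabel) (auto simp: S_simps)
  have S12: "S.info {UU, UW} = cond_info b Z rvYs (\<lambda>z. (rvU z, rvW z)) rvQ"
    unfolding S_info by (rule cinfo_relabel) (auto simp: S_simps)
  \<comment> \<open>The seven nonempty subsets correspond to the seven primary rate bounds; the
    secondary receiver has three of each.\<close>
  have P_rates: "(\<Sum>k\<in>A. rate k) \<le> P.info A" if "A \<noteq> {}" "A \<subseteq> {UX1, UX2, UW}" for A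
  proof -
    have "A \<in> Pow {UX1, UX2, UW}" using that by blast
    then have "A = {UX1} \<or> A = {UX2} \<or> A = {UW} \<or> A = {UX1, UX2} \<or> A = {UX1, UW} \<or>
        A = {UX2, UW} \<or> A = {UX1, UX2, UW}"
      using that(1) unfolding Pow_insert Pow_empty by auto
    then show ?thesis
      using rates_p unfolding P1[symmetric] P2[symmetric] P3[symmetric] P12[symmetric] P13[symmetric]
        P23[symmetric] P123[symmetric]
      by (elim disjE) (simp_all add: rate_def)
  qed
  have S_rates: "(\<Sum>k\<in>A. rate k) \<le> S.info A" if "A \<noteq> {}" "A \<subseteq> {UU, UW}" for A
  proof -
    have "A \<in> Pow {UU, UW}" using that by blast
    then have "A = {UU} \<or> A = {UW} \<or> A = {UU, UW}"
      using that(1) unfolding Pow_insert Pow_empty by auto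
    then show ?thesis
      using rates_s unfolding S1[symmetric] S2[symmetric] S12[symmetric]
      by (elim disjE) (simp_all add: rate_def)
  qed
  show ?thesis
    unfolding achievable_def
  proof (intro conjI allI impI nonneg)
    fix \<eta> \<epsilon> :: real assume \<eta>: "0 < \<eta>" and \<epsilon>: "0 < \<epsilon> \<and> \<epsilon> < 1"
    obtain ep where ep: "ep \<longlonglongrightarrow> 0" and P_err:
      "\<And>n m. m \<in> messages (P.sizes rate \<eta> n) \<Longrightarrow>
      measure_pmf.expectation (P.random_book n (P.sizes rate \<eta> n))
       (\<lambda>C. measure_pmf.prob (P.received n C m) {y. y \<notin> P.decode n (\<eta> / 2) (P.sizes rate \<eta> n) C m}) \<le> ep n"
      using P.random_coding[OF P_rates \<eta>] by blast
    \<comment> \<open>Codebook law and sizes depend on neither the channel nor the decoded set, so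
      \<open>P\<close> and \<open>S\<close> share them. This lets one random codebook serve both
      receivers.\<close>
    obtain es where es: "es \<longlonglongrightarrow> 0" and S_err:
      "\<And>n m. m \<in> messages (P.sizes rate \<eta> n) \<Longrightarrow>
      measure_pmf.expectation (P.random_book n (P.sizes rate \<eta> n))
       (\<lambda>C. measure_pmf.prob (S.received n C m) {y. y \<notin> S.decode n (\<eta> / 2) (P.sizes rate \<eta> n) C m}) \<le> es n"
      using S.random_coding[OF S_rates \<eta>] by blast
    have "(\<lambda>n. ep n + es n) \<longlonglongrightarrow> 0" using tendsto_add[OF ep es] by simp
    then have "\<forall>\<^sub>F n in sequentially. ep n + es n < \<epsilon> \<and> 0 < n"
      using \<epsilon> by (intro eventually_conj order_tendstoD(2) eventually_gt_at_top) auto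
    then show "\<forall>\<^sub>F n in sequentially. \<exists>M1 M2 Ls Ns x1 x2 xs Dp Ds.
           is_code \<omega> n M1 M2 Ls Ns \<epsilon> x1 x2 xs Dp Ds \<and>
           1 / real n * log b (real M1) \<ge> R1 - \<eta> \<and>
           1 / real n * log b (real M2) \<ge> R2 - \<eta> \<and>
           1 / real n * log b (real Ls) \<ge> S - \<eta> \<and>
           1 / real n * log b (real Ns) \<ge> T - \<eta>"
    proof (rule eventually_mono)
      fix n assume n: "ep n + es n < \<epsilon> \<and> 0 < n"
      let ?M = "P.sizes rate \<eta> n"
      let ?M1 = "?M UX1" and ?M2 = "?M UX2" and ?L = "?M UU" and ?N = "?M UW"
      note M = P.sizes_pos[of rate \<eta> n]
      have rate_ge: "1 / real n * log b (real (?M u)) \<ge> rate u - \<eta>" for u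
      proof -
        have "real n * (rate u - \<eta>) \<le> log b (real (?M u))"
          using b M[of u] P.sizes_ge[of n rate u \<eta>] by (subst le_log_iff) auto
        then show ?thesis using n by (simp add: field_simps)
      qed
      let ?m = "\<lambda>i j k l. case_user i j k l :: user \<Rightarrow> nat"
      have m_messages: "?m i j k l \<in> messages ?M"
        if "i \<in> {1..?M1}" "j \<in> {1..?M2}" "k \<in> {1..?L}" "l \<in> {1..?N}" for i j k l
        using that by (auto simp: messages_def split: user.split)
      define avg :: "(nat \<Rightarrow> nat \<Rightarrow> nat \<Rightarrow> nat \<Rightarrow> real) \<Rightarrow> real" where
        "avg g = 1 / (real ?M1 * real ?M2 * real ?L * real ?N) *
          (\<Sum>i=1..?M1. \<Sum>j=1..?M2. \<Sum>k=1..?L. \<Sum>l=1..?N. g i j k l)" for g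
      let ?Pe = "\<lambda>C i j k l. measure_pmf.prob (P.received n C (?m i j k l))
        {y. y \<notin> P.decode n (\<eta> / 2) ?M C (?m i j k l)}"
      let ?Se = "\<lambda>C i j k l. measure_pmf.prob (S.received n C (?m i j k l))
        {y. y \<notin> S.decode n (\<eta> / 2) ?M C (?m i j k l)}"
      let ?E = "measure_pmf.expectation (P.random_book n ?M)"
      have finC: "finite (set_pmf (P.random_book n ?M))"
        unfolding P.random_book_def by (intro finite_set_Pi_pmf P.finite_letter_book) auto
      note int = integrable_measure_pmf_finite[OF finC]
      have E_avg: "?E (\<lambda>C. avg (g C)) = avg (\<lambda>i j k l. ?E (\<lambda>C. g C i j k l))" for g
        unfolding avg_def
        by (simp only: integral_mult_right_zero Bochner_Integration.integral_sum[OF int])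
      have "?E (\<lambda>C. avg (?Pe C)) \<le> ep n"
        unfolding E_avg unfolding avg_def
        by (intro average_le M P_err m_messages)
      moreover have "?E (\<lambda>C. avg (?Se C)) \<le> es n"
        unfolding E_avg unfolding avg_def
        by (intro average_le M S_err m_messages)
      \<comment> \<open>Bounding the sum of both errors in the mean yields a single codebook; as
        both averages are nonnegative, each of them is then at most \<epsilon>.\<close>
      ultimately have "?E (\<lambda>C. avg (?Pe C) + avg (?Se C)) \<le> \<epsilon>"
        using n by (simp add: Bochner_Integration.integral_add[OF int int])
      then obtain C where C: "avg (?Pe C) + avg (?Se C) \<le> \<epsilon>"
        using exists_le_expectation[OF finC] by blast
      have "0 \<le> avg (?Pe C)" "0 \<le> avg (?Se C)"
        unfolding avg_def by (intro mult_nonneg_nonneg sum_nonneg divide_nonneg_nonneg; simp)+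
      with C have avg_le: "avg (?Pe C) \<le> \<epsilon>" "avg (?Se C) \<le> \<epsilon>" by linarith+
      \<comment> \<open>Fixing \<open>C\<close> also fixes the time-sharing sequence, so
        \<open>f\<close> gives a deterministic encoder.\<close>
      define x1 :: "nat \<Rightarrow> nat \<Rightarrow> 'x1" where "x1 i = (\<lambda>t\<in>{..<n}. from_nat (snd (C t) (UX1, i)))" for i
      define x2 :: "nat \<Rightarrow> nat \<Rightarrow> 'x2" where "x2 j = (\<lambda>t\<in>{..<n}. from_nat (snd (C t) (UX2, j)))" for j
      define xs where "xs k l = (\<lambda>t\<in>{..<n}. f (snd (C t) (UU, k)) (snd (C t) (UW, l)) (fst (C t)))" for k l
      \<comment> \<open>The 1 is a placeholder for the index \<open>k\<close>, which this receiver
        does not decode; every other value gives the same set.\<close>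
      define Dp where "Dp i j l = P.decode n (\<eta> / 2) ?M C (?m i j 1 l)" for i j l
      define Ds where "Ds k l = S.decode n (\<eta> / 2) ?M C (?m 1 1 k l)" for k l
      have recP: "memoryless n (marg_p \<omega>) (x1 i) (x2 j) (xs k l) = P.received n C (?m i j k l)" for i j k l
        unfolding memoryless_def P.received_def
        by (intro Pi_pmf_cong) (auto simp: x1_def x2_def xs_def Vp_def letter_channel_def codewords_def)
      have recS: "memoryless n (marg_s \<omega>) (x1 i) (x2 j) (xs k l) = S.received n C (?m i j k l)" for i j k l
        unfolding memoryless_def S.received_def
        by (intro Pi_pmf_cong) (auto simp: x1_def x2_def xs_def Vs_def letter_channel_def codewords_def)
      have Dp: "Dp i j l = P.decode n (\<eta> / 2) ?M C (?m i j k l)" for i j k l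
        unfolding Dp_def by (rule P.decode_cong) auto
      have Ds: "Ds k l = S.decode n (\<eta> / 2) ?M C (?m i j k l)" for i j k l
        unfolding Ds_def by (rule S.decode_cong) auto
      have disjP: "disjoint_family_on (\<lambda>(i, j, l). Dp i j l) ({1..?M1} \<times> {1..?M2} \<times> {1..?N})"
      proof (unfold disjoint_family_on_def, intro ballI impI)
        fix a a' assume in_range: "a \<in> {1..?M1} \<times> {1..?M2} \<times> {1..?N}" and neq: "a \<noteq> a'"
        obtain i j l i' j' l' where a: "a = (i, j, l)" "a' = (i', j', l')" by (cases a, cases a')
        have r: "i \<in> {1..?M1}" "j \<in> {1..?M2}" "l \<in> {1..?N}" and ne: "(i, j, l) \<noteq> (i', j', l')"
          using in_range neq by (simp_all add: a)
        have "?m i j 1 l \<in> messages ?M" using r M[of UU] by (intro m_messages) auto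
        moreover obtain u where "u \<in> {UX1, UX2, UW}" "?m i j 1 l u \<noteq> ?m i' j' 1 l' u"
          using ne by force
        ultimately have "Dp i j l \<inter> Dp i' j' l' = {}" unfolding Dp_def by (rule P.decode_disjoint)
        then show "(case a of (i, j, l) \<Rightarrow> Dp i j l) \<inter> (case a' of (i, j, l) \<Rightarrow> Dp i j l) = {}"
          by (simp add: a)
      qed
      have disjS: "disjoint_family_on (\<lambda>(k, l). Ds k l) ({1..?L} \<times> {1..?N})"
      proof (unfold disjoint_family_on_def, intro ballI impI)
        fix a a' assume in_range: "a \<in> {1..?L} \<times> {1..?N}" and neq: "a \<noteq> a'"
        obtain k l k' l' where a: "a = (k, l)" "a' = (k', l')" by (cases a, cases a')
        have r: "k \<in> {1..?L}" "l \<in> {1..?N}" and ne: "(k, l) \<noteq> (k', l')"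
          using in_range neq by (simp_all add: a)
        have "?m 1 1 k l \<in> messages ?M" using r M[of UX1] M[of UX2] by (intro m_messages) auto
        moreover obtain u where "u \<in> {UU, UW}" "?m 1 1 k l u \<noteq> ?m 1 1 k' l' u"
          using ne by force
        ultimately have "Ds k l \<inter> Ds k' l' = {}" unfolding Ds_def by (rule S.decode_disjoint)
        then show "(case a of (k, l) \<Rightarrow> Ds k l) \<inter> (case a' of (k, l) \<Rightarrow> Ds k l) = {}"
          by (simp add: a)
      qed
      have errP: "1 / (real ?M1 * real ?M2 * real ?L * real ?N) *
       (\<Sum>i=1..?M1. \<Sum>j=1..?M2. \<Sum>k=1..?L. \<Sum>l=1..?N.
          measure_pmf.prob (memoryless n (marg_p \<omega>) (x1 i) (x2 j) (xs k l)) {y. y \<notin> Dp i j l}) \<le> \<epsilon>"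
        using avg_le(1) by (simp only: avg_def recP Dp[symmetric])
      have errS: "1 / (real ?M1 * real ?M2 * real ?L * real ?N) *
       (\<Sum>i=1..?M1. \<Sum>j=1..?M2. \<Sum>k=1..?L. \<Sum>l=1..?N.
          measure_pmf.prob (memoryless n (marg_s \<omega>) (x1 i) (x2 j) (xs k l)) {y. y \<notin> Ds k l}) \<le> \<epsilon>"
        using avg_le(2) by (simp only: avg_def recS Ds[symmetric])
      have "is_code \<omega> n ?M1 ?M2 ?L ?N \<epsilon> x1 x2 xs Dp Ds"
        unfolding is_code_def
        by (intro conjI M ballI disjP disjS errP errS)
          (auto simp: x1_def x2_def xs_def Dp_def Ds_def P.decode_def S.decode_def)
      then show "\<exists>M1 M2 Ls Ns x1 x2 xs Dp Ds.
           is_code \<omega> n M1 M2 Ls Ns \<epsilon> x1 x2 xs Dp Ds \<and>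
           1 / real n * log b (real M1) \<ge> R1 - \<eta> \<and>
           1 / real n * log b (real M2) \<ge> R2 - \<eta> \<and>
           1 / real n * log b (real Ls) \<ge> S - \<eta> \<and>
           1 / real n * log b (real Ns) \<ge> T - \<eta>"
        using rate_ge[of UX1] rate_ge[of UX2] rate_ge[of UU] rate_ge[of UW]
        unfolding rate_def user.case by blast
    qed
  qed
qed

section \<open>Passage to the closure by compactness\<close>

theorem corollary2:
  fixes b :: real
    and \<omega> :: "'x1::finite \<Rightarrow> 'x2::finite \<Rightarrow> 'xs::finite \<Rightarrow> ('yp::finite \<times> 'ys::finite) pmf"
    and Rs Rp :: real
  assumes "1 < b"
    and "(Rs, Rp) \<in> inner_region b \<omega>"
  shows "\<exists>R1 R2 S T. 0 \<le> R1 \<and> 0 \<le> R2 \<and> 0 \<le> S \<and> 0 \<le> T \<and>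
           R1 + R2 = Rp \<and> S + T = Rs \<and> achievable b \<omega> R1 R2 S T"
proof -
  obtain x where x: "\<And>n. x n \<in> (\<Union>Z \<in> P_star \<omega>. rate_region b Z)" and lim: "x \<longlonglongrightarrow> (Rs, Rp)"
    using assms(2) unfolding inner_region_def closure_sequential by blast
  have "\<exists>R1 R2 S T. x n = (S + T, R1 + R2) \<and> achievable b \<omega> R1 R2 S T" for n
  proof -
    obtain Z where "Z \<in> P_star \<omega>" "x n \<in> rate_region b Z" using x[of n] by blast
    then show ?thesis
      unfolding rate_region_def using achievable_of_P_star[OF assms(1), of Z \<omega>] by blast
  qed
  then obtain R1 R2 S T where R: "\<And>n. x n = (S n + T n, R1 n + R2 n)"
      and ach: "\<And>n. achievable b \<omega> (R1 n) (R2 n) (S n) (T n)"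
    by metis
  have nn: "0 \<le> R1 n" "0 \<le> R2 n" "0 \<le> S n" "0 \<le> T n" for n
    using ach[of n] unfolding achievable_def by blast+
  have "bounded (range x)" using lim by (rule convergent_imp_bounded)
  then obtain B where B: "\<And>n. norm (x n) \<le> B" unfolding bounded_iff by blast
  \<comment> \<open>Convergence of the sums does not make the splittings converge. Nonnegativity
    bounds each rate by its sum, so the splittings lie in a bounded box and a subsequence
    converges.\<close>
  let ?F = "\<lambda>n. (R1 n, R2 n, S n, T n)"
  have "bounded (range ?F)"
  proof -
    have "\<bar>S n + T n\<bar> \<le> B" "\<bar>R1 n + R2 n\<bar> \<le> B" for n
      using B[of n] norm_fst_le[of "S n + T n" "R1 n + R2 n"] norm_snd_le[of "R1 n + R2 n" "S n + T n"]
      unfolding R real_norm_def by linarith+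
    then have "R1 n \<in> {0..B}" "R2 n \<in> {0..B}" "S n \<in> {0..B}" "T n \<in> {0..B}" for n
      using nn[of n] by (smt (verit) atLeastAtMost_iff)+
    then have "range ?F \<subseteq> {0..B} \<times> {0..B} \<times> {0..B} \<times> {0..B}" by blast
    then show ?thesis by (rule bounded_subset[rotated]) (intro bounded_Times bounded_closed_interval)
  qed
  then obtain l r where r: "strict_mono r" and l: "(?F \<circ> r) \<longlonglongrightarrow> l"
    using bounded_imp_convergent_subsequence by blast
  obtain r1 r2 s t where lt: "l = (r1, r2, s, t)" by (cases l)
  have L: "(\<lambda>n. R1 (r n)) \<longlonglongrightarrow> r1" "(\<lambda>n. R2 (r n)) \<longlonglongrightarrow> r2" "(\<lambda>n. S (r n)) \<longlonglongrightarrow> s" "(\<lambda>n. T (r n)) \<longlonglongrightarrow> t"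
    using tendsto_fst[OF l] tendsto_fst[OF tendsto_snd[OF l]] tendsto_fst[OF tendsto_snd[OF tendsto_snd[OF l]]]
      tendsto_snd[OF tendsto_snd[OF tendsto_snd[OF l]]]
    by (simp_all add: lt o_def)
  have x_lim: "(\<lambda>n. x (r n)) \<longlonglongrightarrow> (Rs, Rp)"
    using LIMSEQ_subseq_LIMSEQ[OF lim r] by (simp add: o_def)
  have "(\<lambda>n. S (r n) + T (r n)) \<longlonglongrightarrow> Rs" "(\<lambda>n. R1 (r n) + R2 (r n)) \<longlonglongrightarrow> Rp"
    using tendsto_fst[OF x_lim] tendsto_snd[OF x_lim] by (simp_all add: R)
  then have "s + t = Rs" "r1 + r2 = Rp"
    using tendsto_add[OF L(3,4)] tendsto_add[OF L(1,2)] LIMSEQ_unique by blast+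
  moreover have A: "achievable b \<omega> r1 r2 s t"
    by (rule achievable_closed[OF ach L])
  moreover have "0 \<le> r1" "0 \<le> r2" "0 \<le> s" "0 \<le> t"
    using A unfolding achievable_def by blast+
  ultimately show ?thesis by blast
qed

end
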